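(* The operation $\boxplus:\mathbb{M}\times\mathbb{M}\to\mathbb{M}$ is continuous. More specifically, if $\mathcal{X}_i,\mathcal{Y}_i$, $i=1,2$, are elements of $\mathbb{M}$, then $$d_{\mathrm{GPr}}(\mathcal{X}_1\boxplus\mathcal{X}_2,\mathcal{Y}_1\boxplus\mathcal{Y}_2)\le d_{\mathrm{GPr}}(\mathcal{X}_1,\mathcal{Y}_1)+d_{\mathrm{GPr}}(\mathcal{X}_2,\mathcal{Y}_2).$$
   Context: A metric measure space is a triple $\mathcal{X}=(X,r_X,\mu_X)$ where $(X,r_X)$ is a complete separable metric space and $\mu_X$ is a Borel probability measure on $X$ with full support. Two such spaces are equivalent if there is an isometry from one onto the other that maps the first probability measure to the second by push-forward. $\mathbb{M}$ denotes the set of equivalence classes, and a class is not distinguished from its representatives. For $\mathcal{Y},\mathcal{Z}\in\mathbb{M}$, $\mathcal{Y}\boxplus\mathcal{Z}:=(Y\times Z,\,r_Y\oplus r_Z,\,\mu_Y\otimes\mu_Z)$ with $(r_Y\oplus r_Z)((y',z'),(y'',z''))=r_Y(y',y'')+r_Z(z',z'')$. $\mathbb{M}$ carries the topology of the Gromov–Prohorov metric $d_{\mathrm{GPr}}(\mathcal{X},\mathcal{Y}):=\inf d_{\mathrm{Pr}}^{(Z,r_Z)}(\mu_X\circ\phi_X^{-1},\mu_Y\circ\phi_Y^{-1})$, where the infimum is over all metric spaces $(Z,r_Z)$ and isometric embeddings $\phi_X:X\to Z$, $\phi_Y:Y\to Z$. Here $d_{\mathrm{Pr}}^{(Z,r_Z)}$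 is the Prohorov metric: $d_{\mathrm{Pr}}^{(Z,r_Z)}(\mu_1,\mu_2):=\inf\{\epsilon>0:\mu_1(F)\le\mu_2(F^\epsilon)+\epsilon\ \forall F\text{ closed}\}$, with $F^\epsilon:=\{z\in Z:r_Z(z,z')<\epsilon\text{ for some }z'\in F\}$. *)

theory Defs
  imports "HOL-Probability.Probability"
begin

section \<open>Metric measure spaces\<close>

text \<open>
  Points, metric and measure, without any axioms; \<open>mm_space\<close> below singles out the metric measure
  spaces. The points form a subset of the type \<^typ>\<open>'a\<close>, namely the carrier of the metric.
\<close>

datatype 'a mms = Mms (mms_metric: "'a metric") (mms_measure: "'a measure")

abbreviation pts :: "'a mms \<Rightarrow> 'a set"
  where "pts X \<equiv> mspace (mms_metric X)"

abbreviation mdst :: "'a mms \<Rightarrow> 'a \<Rightarrow> 'a \<Rightarrow> real"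
  where "mdst X \<equiv> mdist (mms_metric X)"

definition borel_of :: "'a topology \<Rightarrow> 'a measure"
  where "borel_of T = sigma (topspace T) {U. openin T U}"

definition full_support :: "'a topology \<Rightarrow> 'a measure \<Rightarrow> bool"
  where "full_support T \<mu> \<longleftrightarrow> (\<forall>U. openin T U \<and> U \<noteq> {} \<longrightarrow> 0 < measure \<mu> U)"

definition mm_space :: "'a mms \<Rightarrow> bool"
  where "mm_space X \<longleftrightarrow>
    mcomplete_of (mms_metric X) \<and>
    separable_space (mtopology_of (mms_metric X)) \<and>
    prob_space (mms_measure X) \<and>
    sets (mms_measure X) = sets (borel_of (mtopology_of (mms_metric X))) \<and>
    full_support (mtopology_of (mms_metric X)) (mms_measure X)"

definition isometric_embedding :: "'a metric \<Rightarrow> 'b metric \<Rightarrow> ('a \<Rightarrow> 'b) \<Rightarrow> bool"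
  where "isometric_embedding m m' f \<longleftrightarrow>
    f \<in> mspace m \<rightarrow> mspace m' \<and>
    (\<forall>x\<in>mspace m. \<forall>y\<in>mspace m. mdist m' (f x) (f y) = mdist m x y)"

definition mm_iso :: "'a mms \<Rightarrow> 'b mms \<Rightarrow> bool"
  where "mm_iso X Y \<longleftrightarrow>
    (\<exists>f. isometric_embedding (mms_metric X) (mms_metric Y) f \<and> f ` pts X = pts Y \<and>
         distr (mms_measure X) (mms_measure Y) f = mms_measure Y)"

lemma space_borel_of [simp]: "space (borel_of T) = topspace T"
  unfolding borel_of_def by (rule space_measure_of) (auto dest: openin_subset)

lemma sets_borel_of: "sets (borel_of T) = sigma_sets (topspace T) {U. openin T U}"
  unfolding borel_of_def by (rule sets_measure_of) (auto dest: openin_subset)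

lemma continuous_map_measurable:
  assumes "continuous_map S T f"
  shows "f \<in> borel_of S \<rightarrow>\<^sub>M borel_of T"
proof (rule measurable_sigma_sets[where \<Omega> = "topspace T" and A = "{U. openin T U}"])
  show "sets (borel_of T) = sigma_sets (topspace T) {U. openin T U}"
    by (rule sets_borel_of)
  show "{U. openin T U} \<subseteq> Pow (topspace T)"
    by (auto dest: openin_subset)
  show "f \<in> space (borel_of S) \<rightarrow> topspace T"
    using assms by (auto simp: continuous_map_def)
  fix U assume "U \<in> {U. openin T U}"
  then have "openin S {x \<in> topspace S. f x \<in> U}"
    using assms by (auto simp: continuous_map_def)
  moreover have "f -` U \<inter> space (borel_of S) = {x \<in> topspace S. f x \<in> U}"
    by auto
  ultimately show "f -` U \<inter> space (borel_of S) \<in> sets (borel_of S)"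
    by (simp add: sets_borel_of)
qed

lemma isometric_embedding_continuous:
  assumes "isometric_embedding m m' f"
  shows "continuous_map (mtopology_of m) (mtopology_of m') f"
proof -
  interpret M12: Metric_space12 "mspace m" "mdist m" "mspace m'" "mdist m'"
    by (simp add: Metric_space12_def)
  have "embedding_map M12.M1.mtopology M12.M2.mtopology f"
    using assms unfolding isometric_embedding_def
    by (intro M12.isometry_imp_embedding_map) auto
  then show ?thesis
    by (simp add: mtopology_of_def embedding_map_def homeomorphic_imp_continuous_map
        continuous_map_in_subtopology)
       (metis continuous_map_in_subtopology homeomorphic_imp_continuous_map)
qed

lemma isometric_embedding_measurable:
  assumes "isometric_embedding m m' f"
  shows "f \<in> borel_of (mtopology_of m) \<rightarrow>\<^sub>M borel_of (mtopology_of m')"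
  by (rule continuous_map_measurable[OF isometric_embedding_continuous[OF assms]])

lemma isometric_embedding_comp:
  assumes "isometric_embedding m m' f" "isometric_embedding m' m'' g"
  shows "isometric_embedding m m'' (g \<circ> f)"
  using assms unfolding isometric_embedding_def by (auto simp: Pi_iff)

lemma isometric_embedding_inj_on:
  assumes "isometric_embedding m m' f"
  shows "inj_on f (mspace m)"
  using assms unfolding isometric_embedding_def
  by (metis inj_onI mdist_zero)

lemma isometric_embedding_inv:
  assumes "isometric_embedding m m' f" "f ` mspace m = mspace m'"
  shows "isometric_embedding m' m (inv_into (mspace m) f)"
proof -
  have "inv_into (mspace m) f y \<in> mspace m" "f (inv_into (mspace m) f y) = y"
    if "y \<in> mspace m'" for y
    using that assms(2) by (metis inv_into_into, metis f_inv_into_f)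
  then show ?thesis
    using assms(1) unfolding isometric_embedding_def by (auto simp: Pi_iff) (metis)
qed

lemma mm_spaceD:
  assumes "mm_space X"
  shows "prob_space (mms_measure X)"
    and "sets (mms_measure X) = sets (borel_of (mtopology_of (mms_metric X)))"
    and "space (mms_measure X) = pts X"
    and "separable_space (mtopology_of (mms_metric X))"
  using assms sets_eq_imp_space_eq[of "mms_measure X" "borel_of (mtopology_of (mms_metric X))"]
  unfolding mm_space_def by auto

lemma mm_iso_refl: "mm_iso X X"
  unfolding mm_iso_def isometric_embedding_def
  by (rule exI[of _ "\<lambda>x. x"]) (auto simp: distr_id)

lemma mm_iso_sym:
  assumes "mm_space X" "mm_space Y" "mm_iso X Y"
  shows "mm_iso Y X"
proof -
  obtain f where f: "isometric_embedding (mms_metric X) (mms_metric Y) f" "f ` pts X = pts Y"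
    "distr (mms_measure X) (mms_measure Y) f = mms_measure Y"
    using assms(3) unfolding mm_iso_def by blast
  let ?g = "inv_into (pts X) f"
  have g: "isometric_embedding (mms_metric Y) (mms_metric X) ?g"
    by (rule isometric_embedding_inv[OF f(1,2)])
  have "distr (mms_measure Y) (mms_measure X) ?g
      = distr (distr (mms_measure X) (mms_measure Y) f) (mms_measure X) ?g"
    by (simp only: f(3))
  also have "\<dots> = distr (mms_measure X) (mms_measure X) (?g \<circ> f)"
    using isometric_embedding_measurable[OF f(1)] isometric_embedding_measurable[OF g]
    by (intro distr_distr)
       (simp_all add: measurable_cong_sets[OF mm_spaceD(2)[OF assms(1)] mm_spaceD(2)[OF assms(2)]]
         measurable_cong_sets[OF mm_spaceD(2)[OF assms(2)] mm_spaceD(2)[OF assms(1)]])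
  also have "\<dots> = distr (mms_measure X) (mms_measure X) (\<lambda>x. x)"
    using isometric_embedding_inj_on[OF f(1)]
    by (intro distr_cong) (auto simp: mm_spaceD(3)[OF assms(1)])
  also have "\<dots> = mms_measure X" by (rule distr_id)
  finally have "distr (mms_measure Y) (mms_measure X) ?g = mms_measure X" .
  moreover have "?g ` pts Y = pts X"
    using isometric_embedding_inj_on[OF f(1)] f(2) by (metis inv_into_image_cancel subset_refl)
  ultimately show ?thesis
    unfolding mm_iso_def using g by blast
qed

lemma mm_iso_trans:
  assumes "mm_space X" "mm_space Y" "mm_space Z" "mm_iso X Y" "mm_iso Y Z"
  shows "mm_iso X Z"
proof -
  obtain f where f: "isometric_embedding (mms_metric X) (mms_metric Y) f" "f ` pts X = pts Y"
    "distr (mms_measure X) (mms_measure Y) f = mms_measure Y"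
    using assms(4) unfolding mm_iso_def by blast
  obtain g where g: "isometric_embedding (mms_metric Y) (mms_metric Z) g" "g ` pts Y = pts Z"
    "distr (mms_measure Y) (mms_measure Z) g = mms_measure Z"
    using assms(5) unfolding mm_iso_def by blast
  have "distr (mms_measure X) (mms_measure Z) (g \<circ> f)
      = distr (distr (mms_measure X) (mms_measure Y) f) (mms_measure Z) g"
    using isometric_embedding_measurable[OF f(1)] isometric_embedding_measurable[OF g(1)]
    by (intro distr_distr[symmetric])
       (simp_all add: measurable_cong_sets[OF mm_spaceD(2)[OF assms(1)] mm_spaceD(2)[OF assms(2)]]
         measurable_cong_sets[OF mm_spaceD(2)[OF assms(2)] mm_spaceD(2)[OF assms(3)]])
  also have "\<dots> = mms_measure Z" by (simp add: f g)
  finally show ?thesis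
    unfolding mm_iso_def using isometric_embedding_comp[OF f(1) g(1)] f(2) g(2)
    by (metis image_comp)
qed


section \<open>The Gromov--Prohorov metric\<close>

definition enlargement :: "'a metric \<Rightarrow> 'a set \<Rightarrow> real \<Rightarrow> 'a set"
  where "enlargement m F \<epsilon> = {z \<in> mspace m. \<exists>z'\<in>F. mdist m z z' < \<epsilon>}"

definition prohorov :: "'a metric \<Rightarrow> 'a measure \<Rightarrow> 'a measure \<Rightarrow> real"
  where "prohorov m \<mu> \<nu> =
    Inf {\<epsilon>. 0 < \<epsilon> \<and> (\<forall>F. closedin (mtopology_of m) F \<longrightarrow>
                        measure \<mu> F \<le> measure \<nu> (enlargement m F \<epsilon>) + \<epsilon>)}"

text \<open>
  A complete separable metric space has at most continuum many points, so every metric measure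
  space has an isometric copy with points in \<^typ>\<open>nat \<Rightarrow> real\<close> (\<open>mm_space_copy\<close>).
  The points of the ambient spaces \<open>Z\<close> in the Gromov--Prohorov metric are drawn from the same type.
  This does not change the infimum: the Prohorov distance of the two image measures depends only on
  the subspace formed by the union of the two embedded copies (\<open>gpr_dist_le\<close>).
\<close>

type_synonym point = "nat \<Rightarrow> real"

definition gpr_dist :: "'a mms \<Rightarrow> 'b mms \<Rightarrow> real"
  where "gpr_dist X Y =
    Inf {prohorov Z (distr (mms_measure X) (borel_of (mtopology_of Z)) \<phi>)
                    (distr (mms_measure Y) (borel_of (mtopology_of Z)) \<psi>)
         | (Z :: point metric) \<phi> \<psi>.
           isometric_embedding (mms_metric X) Z \<phi> \<and> isometric_embedding (mms_metric Y) Z \<psi>}"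

definition sum_metric :: "'a metric \<Rightarrow> 'b metric \<Rightarrow> ('a \<times> 'b) metric"
  where "sum_metric m m' =
    metric (mspace m \<times> mspace m', \<lambda>(y', z') (y'', z''). mdist m y' y'' + mdist m' z' z'')"

definition mm_sum :: "'a mms \<Rightarrow> 'b mms \<Rightarrow> ('a \<times> 'b) mms"
  where "mm_sum Y Z =
    Mms (sum_metric (mms_metric Y) (mms_metric Z)) (mms_measure Y \<Otimes>\<^sub>M mms_measure Z)"

lemma mm_space_singleton:
  "mm_space (Mms (metric ({x}, \<lambda>a b. if a = b then 0 else 1)) (return (count_space {x}) x))"
proof -
  interpret Metric_space "{x}" "\<lambda>a b. if a = b then 0 else 1 :: real"
    by unfold_locales auto
  have top: "mtopology = discrete_topology {x}"
    by (metis subtopology_eq_discrete_topology_sing topspace_mtopology subtopology_topspace)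
  have sep: "separable_space mtopology"
    unfolding top by (simp only: separable_space_discrete_topology) simp
  have mc: "mcomplete"
  proof (unfold mcomplete_def, intro allI impI)
    fix \<sigma> assume A: "MCauchy \<sigma>"
    have s: "\<sigma> n = x" for n
      using A unfolding MCauchy_def by (metis range_subsetD singletonD)
    have "limitin mtopology \<sigma> x sequentially"
      unfolding limitin_def top by (simp add: s)
    then show "\<exists>x. limitin mtopology \<sigma> x sequentially" ..
  qed
  have "sets (borel_of mtopology) \<subseteq> Pow {x}"
    using sets.space_closed[of "borel_of mtopology"] by (simp add: top)
  moreover have "Pow {x} \<subseteq> sets (borel_of mtopology)"
    unfolding sets_borel_of top by (intro subsetI sigma_sets.Basic) simp
  ultimately have sets: "sets (borel_of mtopology) = Pow {x}" by (rule equalityI)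
  have supp: "full_support mtopology (return (count_space {x}) x)"
    unfolding full_support_def top
  proof (intro allI impI)
    fix U assume "openin (discrete_topology {x}) U \<and> U \<noteq> {}"
    then have "U = {x}" by auto
    then show "0 < measure (return (count_space {x}) x) U"
      by (simp add: measure_return)
  qed
  have prob: "prob_space (return (count_space {x}) x)"
    by (rule prob_space_return) simp
  show ?thesis
    unfolding mm_space_def mms.sel mtopology_of mcomplete_of sets sets_return
    using sep mc prob supp by simp
qed

text \<open>The type \<open>mm\<close> is the set of all equivalence classes of metric measure spaces.\<close>

quotient_type mm = "point mms" / partial: "\<lambda>X Y. mm_space X \<and> mm_space Y \<and> mm_iso X Y"
proof (rule part_equivpI)
  show "\<exists>X :: point mms. mm_space X \<and> mm_space X \<and> mm_iso X X"
    by (intro exI conjI) (rule mm_space_singleton mm_iso_refl)+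
  show "symp (\<lambda>X Y :: point mms. mm_space X \<and> mm_space Y \<and> mm_iso X Y)"
  proof (rule sympI, elim conjE)
    fix X Y :: "point mms" assume "mm_space X" "mm_space Y" "mm_iso X Y"
    then show "mm_space Y \<and> mm_space X \<and> mm_iso Y X"
      using mm_iso_sym[of X Y] by simp
  qed
  show "transp (\<lambda>X Y :: point mms. mm_space X \<and> mm_space Y \<and> mm_iso X Y)"
  proof (rule transpI, elim conjE)
    fix X Y Z :: "point mms"
    assume "mm_space X" "mm_space Y" "mm_iso X Y" "mm_space Z" "mm_iso Y Z"
    then show "mm_space X \<and> mm_space Z \<and> mm_iso X Z"
      using mm_iso_trans[of X Y Z] by simp
  qed
qed

lemma isometric_embedding_transfer:
  assumes X: "mm_space X" "mm_space X'" "mm_iso X X'"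
    and \<phi>: "isometric_embedding (mms_metric X') Z \<phi>"
  obtains \<phi>' where "isometric_embedding (mms_metric X) Z \<phi>'"
    and "distr (mms_measure X) (borel_of (mtopology_of Z)) \<phi>' =
      distr (mms_measure X') (borel_of (mtopology_of Z)) \<phi>"
proof -
  obtain f where f: "isometric_embedding (mms_metric X) (mms_metric X') f"
    "distr (mms_measure X) (mms_measure X') f = mms_measure X'"
    using X(3) unfolding mm_iso_def by blast
  have "distr (mms_measure X) (borel_of (mtopology_of Z)) (\<phi> \<circ> f) =
    distr (distr (mms_measure X) (mms_measure X') f) (borel_of (mtopology_of Z)) \<phi>"
    using isometric_embedding_measurable[OF f(1)] isometric_embedding_measurable[OF \<phi>]
    by (intro distr_distr[symmetric])
       (simp_all add: measurable_cong_sets[OF mm_spaceD(2)[OF X(1)] mm_spaceD(2)[OF X(2)]]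
         measurable_cong_sets[OF mm_spaceD(2)[OF X(2)] refl])
  then show ?thesis
    using isometric_embedding_comp[OF f(1) \<phi>] f(2) that by metis
qed

lemma gpr_dist_cong_aux:
  assumes "mm_space X" "mm_space X'" "mm_space Y" "mm_space Y'" "mm_iso X X'" "mm_iso Y Y'"
  shows "{prohorov Z (distr (mms_measure X') (borel_of (mtopology_of Z)) \<phi>)
                    (distr (mms_measure Y') (borel_of (mtopology_of Z)) \<psi>)
         | (Z :: point metric) \<phi> \<psi>.
           isometric_embedding (mms_metric X') Z \<phi> \<and> isometric_embedding (mms_metric Y') Z \<psi>}
  \<subseteq> {prohorov Z (distr (mms_measure X) (borel_of (mtopology_of Z)) \<phi>)
                    (distr (mms_measure Y) (borel_of (mtopology_of Z)) \<psi>)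
         | (Z :: point metric) \<phi> \<psi>.
           isometric_embedding (mms_metric X) Z \<phi> \<and> isometric_embedding (mms_metric Y) Z \<psi>}"
proof (rule subsetI, elim CollectE exE conjE)
  fix p and Z :: "point metric" and \<phi> \<psi>
  assume p: "p = prohorov Z (distr (mms_measure X') (borel_of (mtopology_of Z)) \<phi>)
                    (distr (mms_measure Y') (borel_of (mtopology_of Z)) \<psi>)"
    and \<phi>: "isometric_embedding (mms_metric X') Z \<phi>"
    and \<psi>: "isometric_embedding (mms_metric Y') Z \<psi>"
  obtain \<phi>' where \<phi>': "isometric_embedding (mms_metric X) Z \<phi>'"
    "distr (mms_measure X) (borel_of (mtopology_of Z)) \<phi>' =
      distr (mms_measure X') (borel_of (mtopology_of Z)) \<phi>"
    by (rule isometric_embedding_transfer[OF assms(1,2,5) \<phi>])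
  obtain \<psi>' where \<psi>': "isometric_embedding (mms_metric Y) Z \<psi>'"
    "distr (mms_measure Y) (borel_of (mtopology_of Z)) \<psi>' =
      distr (mms_measure Y') (borel_of (mtopology_of Z)) \<psi>"
    by (rule isometric_embedding_transfer[OF assms(3,4,6) \<psi>])
  show "p \<in> {prohorov Z (distr (mms_measure X) (borel_of (mtopology_of Z)) \<phi>)
                    (distr (mms_measure Y) (borel_of (mtopology_of Z)) \<psi>)
         | (Z :: point metric) \<phi> \<psi>.
           isometric_embedding (mms_metric X) Z \<phi> \<and> isometric_embedding (mms_metric Y) Z \<psi>}"
    by (intro CollectI exI[of _ Z] exI[of _ \<phi>'] exI[of _ \<psi>'] conjI \<phi>'(1) \<psi>'(1))
       (simp only: p \<phi>'(2) \<psi>'(2))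
qed

lemma gpr_dist_cong:
  assumes "mm_space X" "mm_space X'" "mm_space Y" "mm_space Y'" "mm_iso X X'" "mm_iso Y Y'"
  shows "gpr_dist X Y = gpr_dist X' Y'"
  unfolding gpr_dist_def
  by (intro arg_cong[where f = Inf] equalityI gpr_dist_cong_aux assms
      mm_iso_sym[OF assms(1,2,5)] mm_iso_sym[OF assms(3,4,6)])

lift_definition gpr :: "mm \<Rightarrow> mm \<Rightarrow> real" is gpr_dist
  by (elim conjE) (rule gpr_dist_cong)

text \<open>
  \<open>mm_class X\<close> is the equivalence class of a metric measure space \<open>X\<close> with points of an arbitrary
  type. It is needed because the product of two representatives has points in
  \<^typ>\<open>point \<times> point\<close> and not in \<^typ>\<open>point\<close>.
\<close>

definition mm_class :: "'a mms \<Rightarrow> mm"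
  where "mm_class X = abs_mm (SOME W. mm_space W \<and> mm_iso X W)"

definition boxplus :: "mm \<Rightarrow> mm \<Rightarrow> mm"  (infixl "\<boxplus>" 65)
  where "A \<boxplus> B = mm_class (mm_sum (rep_mm A) (rep_mm B))"

text \<open>
  The usual description of the open sets of a metric. (The library's \<open>Metric_space.mtopology\<close> is
  specified only under a proof that \<open>gpr\<close> separates points, which is not needed here.)
\<close>

definition gpr_topology :: "mm topology"
  where "gpr_topology = topology (\<lambda>U. \<forall>A\<in>U. \<exists>e>0. \<forall>B. gpr A B < e \<longrightarrow> B \<in> U)"


section \<open>Independence of the choices made in the definitions\<close>

text \<open>
  Main facts: \<open>mm_space_mm_sum\<close>, \<open>mm_space_copy\<close>, \<open>mm_class_eq_iff\<close>, \<open>gpr_mm_class\<close>,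
  \<open>boxplus_mm_class\<close>, \<open>openin_gpr_topology\<close> and \<open>gpr_dist_le\<close>.
\<close>

lemma mdist_self: "x \<in> mspace m \<Longrightarrow> mdist m x x = 0"
  by simp

lemma openin_mtopology_of_iff:
  "openin (mtopology_of m) U \<longleftrightarrow>
    U \<subseteq> mspace m \<and> (\<forall>x\<in>U. \<exists>r>0. \<forall>y\<in>mspace m. mdist m x y < r \<longrightarrow> y \<in> U)"
proof -
  interpret Metric_space "mspace m" "mdist m" by (rule Metric_space_mspace_mdist)
  have "mball x r \<subseteq> U \<longleftrightarrow> (\<forall>y\<in>mspace m. mdist m x y < r \<longrightarrow> y \<in> U)"
    if "U \<subseteq> mspace m" "x \<in> U" for x r
    using that by (auto simp: subset_iff)
  then show ?thesis
    unfolding mtopology_of_def openin_mtopology Ball_def[of U] by (intro conj_cong refl) simp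
qed

lemma closure_of_mtopology_of_iff:
  "x \<in> mtopology_of m closure_of S \<longleftrightarrow>
    x \<in> mspace m \<and> (\<forall>r>0. \<exists>y\<in>S \<inter> mspace m. mdist m x y < r)"
proof -
  interpret Metric_space "mspace m" "mdist m" by (rule Metric_space_mspace_mdist)
  have "x \<in> mspace m \<Longrightarrow> (\<exists>y\<in>S. y \<in> mball x r) \<longleftrightarrow> (\<exists>y\<in>S \<inter> mspace m. mdist m x y < r)" for r
    by auto
  then show ?thesis
    unfolding mtopology_of_def metric_closure_of mem_Collect_eq by (intro conj_cong refl) simp
qed

lemma openin_ball_of: "x \<in> mspace m \<Longrightarrow> openin (mtopology_of m) {y \<in> mspace m. mdist m x y < r}"
proof -
  interpret Metric_space "mspace m" "mdist m" by simp
  assume "x \<in> mspace m"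
  then have "{y \<in> mspace m. mdist m x y < r} = mball x r"
    by auto
  then show ?thesis by (simp add: mtopology_of_def)
qed

lemma separable_space_mtopology_of_iff:
  "separable_space (mtopology_of m) \<longleftrightarrow>
    (\<exists>C. countable C \<and> C \<subseteq> mspace m \<and> (\<forall>x\<in>mspace m. \<forall>r>0. \<exists>c\<in>C. mdist m x c < r))"
proof -
  have "mtopology_of m closure_of C = mspace m \<longleftrightarrow>
      (\<forall>x\<in>mspace m. \<forall>r>0. \<exists>c\<in>C. mdist m x c < r)" if "C \<subseteq> mspace m" for C
    using that by (auto simp: set_eq_iff closure_of_mtopology_of_iff Int_absorb2)
  then show ?thesis
    unfolding separable_space_def by (auto intro!: ex_cong)
qed

lemma separable_spaceE:
  assumes "separable_space (mtopology_of m)"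
  obtains C where "countable C" "C \<subseteq> mspace m"
    "\<And>x r. x \<in> mspace m \<Longrightarrow> r > 0 \<Longrightarrow> \<exists>c\<in>C. mdist m x c < r"
proof -
  obtain C where C: "countable C" "C \<subseteq> mspace m" "\<forall>x\<in>mspace m. \<forall>r>0. \<exists>c\<in>C. mdist m x c < r"
    using assms[unfolded separable_space_mtopology_of_iff] by (elim exE conjE)
  show thesis by (rule that[OF C(1,2)]) (rule C(3)[rule_format])
qed

lemma separable_imp_second_countable:
  assumes "separable_space (mtopology_of m)"
  shows "second_countable (mtopology_of m)"
proof -
  obtain C where C: "countable C" "C \<subseteq> mspace m" "\<And>x r. x \<in> mspace m \<Longrightarrow> r > 0 \<Longrightarrow> \<exists>c\<in>C. mdist m x c < r"
    by (rule separable_spaceE[OF assms]) (erule that, assumption, blast)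
  define B where "B = (\<lambda>(c, n). {y \<in> mspace m. mdist m c y < inverse (Suc n)}) ` (C \<times> UNIV)"
  show ?thesis
    unfolding second_countable_def
  proof (intro exI[of _ B] conjI ballI allI impI)
    show "countable B" unfolding B_def using C(1) by simp
    show "openin (mtopology_of m) V" if "V \<in> B" for V
      using that C(2) unfolding B_def by (auto intro!: openin_ball_of)
    fix U x assume U: "openin (mtopology_of m) U \<and> x \<in> U"
    then obtain r where r: "r > 0" "\<And>y. y \<in> mspace m \<Longrightarrow> mdist m x y < r \<Longrightarrow> y \<in> U" and x: "x \<in> mspace m"
      unfolding openin_mtopology_of_iff by blast
    obtain n where n: "inverse (Suc n) < r / 2"
      using reals_Archimedean[of "r / 2"] r(1) by auto
    obtain c where c: "c \<in> C" "mdist m x c < inverse (Suc n)"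
      using C(3)[OF x, of "inverse (Suc n)"] by auto
    show "\<exists>V\<in>B. x \<in> V \<and> V \<subseteq> U"
    proof (intro bexI conjI subsetI)
      show "{y \<in> mspace m. mdist m c y < inverse (Suc n)} \<in> B"
        unfolding B_def using c(1) by auto
      show "x \<in> {y \<in> mspace m. mdist m c y < inverse (Suc n)}"
        using c x by (simp add: mdist_commute)
      fix y assume y: "y \<in> {y \<in> mspace m. mdist m c y < inverse (Suc n)}"
      have "mdist m x y \<le> mdist m x c + mdist m c y"
        using x y c C(2) by (intro mdist_triangle) auto
      then show "y \<in> U" using y c n by (intro r(2)) auto
    qed
  qed
qed

lemma Metric_space_sum_metric:
  "Metric_space (mspace m \<times> mspace m') (\<lambda>(y', z') (y'', z''). mdist m y' y'' + mdist m' z' z'')"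
proof
  fix p q r :: "'a \<times> 'b"
  show "0 \<le> (case p of (y', z') \<Rightarrow> \<lambda>(y'', z''). mdist m y' y'' + mdist m' z' z'') q"
    by (simp add: split_beta)
  show "(case p of (y', z') \<Rightarrow> \<lambda>(y'', z''). mdist m y' y'' + mdist m' z' z'') q =
      (case q of (y', z') \<Rightarrow> \<lambda>(y'', z''). mdist m y' y'' + mdist m' z' z'') p"
    by (simp add: split_beta mdist_commute)
  assume p: "p \<in> mspace m \<times> mspace m'" and q: "q \<in> mspace m \<times> mspace m'"
  then show "((case p of (y', z') \<Rightarrow> \<lambda>(y'', z''). mdist m y' y'' + mdist m' z' z'') q = 0) \<longleftrightarrow> (p = q)"
    by (simp add: split_beta add_nonneg_eq_0_iff mem_Times_iff prod_eq_iff)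
  assume r: "r \<in> mspace m \<times> mspace m'"
  show "(case p of (y', z') \<Rightarrow> \<lambda>(y'', z''). mdist m y' y'' + mdist m' z' z'') r \<le>
      (case p of (y', z') \<Rightarrow> \<lambda>(y'', z''). mdist m y' y'' + mdist m' z' z'') q +
      (case q of (y', z') \<Rightarrow> \<lambda>(y'', z''). mdist m y' y'' + mdist m' z' z'') r"
    using p q r mdist_triangle[of "fst p" m "fst q" "fst r"] mdist_triangle[of "snd p" m' "snd q" "snd r"]
    by (simp add: split_beta mem_Times_iff)
qed

lemma mspace_sum_metric [simp]: "mspace (sum_metric m m') = mspace m \<times> mspace m'"
  unfolding sum_metric_def by (rule Metric_space.mspace_metric[OF Metric_space_sum_metric])

lemma mdist_sum_metric [simp]:
  "mdist (sum_metric m m') (a, b) (a', b') = mdist m a a' + mdist m' b b'"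
  unfolding sum_metric_def by (subst Metric_space.mdist_metric[OF Metric_space_sum_metric]) simp

lemma openin_prod_topologyE:
  assumes "openin (prod_topology S T) U" "(x, y) \<in> U"
  obtains V W where "openin S V" "openin T W" "x \<in> V" "y \<in> W" "V \<times> W \<subseteq> U"
  using assms(1)[unfolded openin_prod_topology_alt, rule_format, OF assms(2)] by (elim exE conjE)

lemma mtopology_of_sum_metric:
  "mtopology_of (sum_metric m m') = prod_topology (mtopology_of m) (mtopology_of m')"
proof (rule topology_eq[THEN iffD2], intro allI iffI)
  fix U assume U: "openin (mtopology_of (sum_metric m m')) U"
  show "openin (prod_topology (mtopology_of m) (mtopology_of m')) U"
    unfolding openin_prod_topology_alt
  proof (intro allI impI)
    fix x y assume xy: "(x, y) \<in> U"
    then obtain r where r: "r > 0"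
      "\<And>z. z \<in> mspace m \<times> mspace m' \<Longrightarrow> mdist (sum_metric m m') (x, y) z < r \<Longrightarrow> z \<in> U"
      and m: "x \<in> mspace m" "y \<in> mspace m'"
      using U unfolding openin_mtopology_of_iff by fastforce
    have "{a \<in> mspace m. mdist m x a < r/2} \<times> {b \<in> mspace m'. mdist m' y b < r/2} \<subseteq> U"
      by (auto intro!: r(2))
    then show "\<exists>V W. openin (mtopology_of m) V \<and> openin (mtopology_of m') W \<and> x \<in> V \<and> y \<in> W \<and> V \<times> W \<subseteq> U"
      using m r(1)
      by (intro exI[of _ "{a \<in> mspace m. mdist m x a < r/2}"]
          exI[of _ "{b \<in> mspace m'. mdist m' y b < r/2}"] conjI openin_ball_of) (simp_all add: mdist_self)
  qed
next
  fix U assume U: "openin (prod_topology (mtopology_of m) (mtopology_of m')) U"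
  show "openin (mtopology_of (sum_metric m m')) U"
    unfolding openin_mtopology_of_iff
  proof (intro conjI ballI)
    show "U \<subseteq> mspace (sum_metric m m')" using openin_subset[OF U] by simp
    fix p assume p: "p \<in> U"
    obtain x y where [simp]: "p = (x, y)" by fastforce
    have xy: "(x, y) \<in> U" using p by simp
    from openin_prod_topologyE[OF U xy] obtain V W where
      VW: "openin (mtopology_of m) V" "openin (mtopology_of m') W" "x \<in> V" "y \<in> W" "V \<times> W \<subseteq> U" .
    obtain r where r: "r > 0" "\<And>a. a \<in> mspace m \<Longrightarrow> mdist m x a < r \<Longrightarrow> a \<in> V"
      using VW(1,3) unfolding openin_mtopology_of_iff by blast
    obtain s where s: "s > 0" "\<And>a. a \<in> mspace m' \<Longrightarrow> mdist m' y a < s \<Longrightarrow> a \<in> W"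
      using VW(2,4) unfolding openin_mtopology_of_iff by blast
    have "z \<in> U" if z: "z \<in> mspace (sum_metric m m')" "mdist (sum_metric m m') p z < min r s" for z
    proof -
      obtain a b where [simp]: "z = (a, b)" by fastforce
      have "mdist m x a + mdist m' y b < min r s" using z(2) by simp
      then have "mdist m x a < r" "mdist m' y b < s"
        using mdist_nonneg[of m x a] mdist_nonneg[of m' y b] by linarith+
      then show ?thesis using r(2)[of a] s(2)[of b] z(1) VW(5) by auto
    qed
    then show "\<exists>r>0. \<forall>y\<in>mspace (sum_metric m m'). mdist (sum_metric m m') p y < r \<longrightarrow> y \<in> U"
      using r(1) s(1) by (intro exI[of _ "min r s"]) auto
  qed
qed

lemma mcomplete_of_sum_metric:
  assumes "mcomplete_of m" "mcomplete_of m'"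
  shows "mcomplete_of (sum_metric m m')"
proof -
  interpret A: Metric_space "mspace m" "mdist m" by simp
  interpret B: Metric_space "mspace m'" "mdist m'" by simp
  interpret S: Metric_space "mspace (sum_metric m m')" "mdist (sum_metric m m')"
    by (rule Metric_space_mspace_mdist)
  show ?thesis
    unfolding mcomplete_of_def S.mcomplete_def
  proof (intro allI impI)
    fix \<sigma> assume c: "S.MCauchy \<sigma>"
    have d: "mdist m (fst p) (fst q) \<le> mdist (sum_metric m m') p q"
      "mdist m' (snd p) (snd q) \<le> mdist (sum_metric m m') p q" for p q
      by (cases p; cases q; simp)+
    have \<sigma>: "fst (\<sigma> n) \<in> mspace m" "snd (\<sigma> n) \<in> mspace m'" for n
      using c unfolding S.MCauchy_def by (auto simp: image_subset_iff mem_Times_iff)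
    have N: "\<exists>N. \<forall>n n'. N \<le> n \<longrightarrow> N \<le> n' \<longrightarrow> mdist (sum_metric m m') (\<sigma> n) (\<sigma> n') < \<epsilon>"
      if "\<epsilon> > 0" for \<epsilon>
      using c that unfolding S.MCauchy_def by blast
    have A: "A.MCauchy (fst \<circ> \<sigma>)"
      unfolding A.MCauchy_def
    proof (intro conjI allI impI)
      fix \<epsilon> :: real assume "\<epsilon> > 0"
      from N[OF this] show "\<exists>N. \<forall>n n'. N \<le> n \<longrightarrow> N \<le> n' \<longrightarrow> mdist m ((fst \<circ> \<sigma>) n) ((fst \<circ> \<sigma>) n') < \<epsilon>"
        unfolding o_def by (elim ex_forward all_forward imp_forward) (assumption | erule le_less_trans[OF d(1)])+
    qed (use \<sigma> in auto)
    have B: "B.MCauchy (snd \<circ> \<sigma>)"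
      unfolding B.MCauchy_def
    proof (intro conjI allI impI)
      fix \<epsilon> :: real assume "\<epsilon> > 0"
      from N[OF this] show "\<exists>N. \<forall>n n'. N \<le> n \<longrightarrow> N \<le> n' \<longrightarrow> mdist m' ((snd \<circ> \<sigma>) n) ((snd \<circ> \<sigma>) n') < \<epsilon>"
        unfolding o_def by (elim ex_forward all_forward imp_forward) (assumption | erule le_less_trans[OF d(2)])+
    qed (use \<sigma> in auto)
    from A B obtain x y where "limitin A.mtopology (fst \<circ> \<sigma>) x sequentially"
      "limitin B.mtopology (snd \<circ> \<sigma>) y sequentially"
      using assms unfolding mcomplete_of_def A.mcomplete_def B.mcomplete_def by blast
    then have "limitin (mtopology_of (sum_metric m m')) \<sigma> (x, y) sequentially"
      unfolding mtopology_of_sum_metric limitin_pairwise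
      by (simp add: mtopology_of_def)
    then show "\<exists>l. limitin S.mtopology \<sigma> l sequentially"
      unfolding mtopology_of_def by blast
  qed
qed

lemma separable_space_sum_metric:
  assumes "separable_space (mtopology_of m)" "separable_space (mtopology_of m')"
  shows "separable_space (mtopology_of (sum_metric m m'))"
proof -
  obtain C where C: "countable C" "C \<subseteq> mspace m" "\<And>x r. x \<in> mspace m \<Longrightarrow> r > 0 \<Longrightarrow> \<exists>c\<in>C. mdist m x c < r"
    by (rule separable_spaceE[OF assms(1)]) (erule that, assumption, blast)
  obtain D where D: "countable D" "D \<subseteq> mspace m'" "\<And>x r. x \<in> mspace m' \<Longrightarrow> r > 0 \<Longrightarrow> \<exists>c\<in>D. mdist m' x c < r"
    by (rule separable_spaceE[OF assms(2)]) (erule that, assumption, blast)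
  show ?thesis
    unfolding separable_space_mtopology_of_iff
  proof (intro exI[of _ "C \<times> D"] conjI ballI allI impI)
    fix p and r :: real assume p: "p \<in> mspace (sum_metric m m')" and r: "r > 0"
    obtain x y where xy: "p = (x, y)" "x \<in> mspace m" "y \<in> mspace m'" using p by auto
    obtain c d where "c \<in> C" "mdist m x c < r/2" "d \<in> D" "mdist m' y d < r/2"
      using C(3)[OF xy(2), of "r/2"] D(3)[OF xy(3), of "r/2"] r by auto
    then show "\<exists>c\<in>C \<times> D. mdist (sum_metric m m') p c < r"
      by (intro bexI[of _ "(c, d)"]) (auto simp: xy)
  qed (use C D in auto)
qed

lemma openin_imp_sets_borel_of: "openin T U \<Longrightarrow> U \<in> sets (borel_of T)"
  by (simp add: sets_borel_of)

lemma sets_borel_of_prod_topology: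
  assumes "second_countable S" "second_countable T"
  shows "sets (borel_of S \<Otimes>\<^sub>M borel_of T) = sets (borel_of (prod_topology S T))"
proof (rule equalityI)
  have "(\<lambda>p. (fst p, snd p)) \<in> borel_of (prod_topology S T) \<rightarrow>\<^sub>M borel_of S \<Otimes>\<^sub>M borel_of T"
    by (intro measurable_Pair continuous_map_measurable continuous_map_fst continuous_map_snd)
  then have m: "(\<lambda>p. p) \<in> borel_of (prod_topology S T) \<rightarrow>\<^sub>M borel_of S \<Otimes>\<^sub>M borel_of T"
    by simp
  show "sets (borel_of S \<Otimes>\<^sub>M borel_of T) \<subseteq> sets (borel_of (prod_topology S T))"
  proof
    fix A assume A: "A \<in> sets (borel_of S \<Otimes>\<^sub>M borel_of T)"
    have "(\<lambda>p. p) -` A \<inter> space (borel_of (prod_topology S T)) = A"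
      using sets.sets_into_space[OF A] by (auto simp: space_pair_measure)
    then show "A \<in> sets (borel_of (prod_topology S T))"
      using measurable_sets[OF m A] by simp
  qed
next
  obtain B where B: "countable B" "\<forall>V\<in>B. openin S V"
    "\<forall>U x. openin S U \<and> x \<in> U \<longrightarrow> (\<exists>V\<in>B. x \<in> V \<and> V \<subseteq> U)"
    using assms(1)[unfolded second_countable_def] by (elim exE conjE)

  obtain D where D: "countable D" "\<forall>V\<in>D. openin T V"
    "\<forall>U x. openin T U \<and> x \<in> U \<longrightarrow> (\<exists>V\<in>D. x \<in> V \<and> V \<subseteq> U)"
    using assms(2)[unfolded second_countable_def] by (elim exE conjE)

  have "U \<in> sets (borel_of S \<Otimes>\<^sub>M borel_of T)" if U: "openin (prod_topology S T) U" for U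
  proof -
    let ?I = "{p \<in> B \<times> D. fst p \<times> snd p \<subseteq> U}"
    have "U \<subseteq> (\<Union>p\<in>?I. fst p \<times> snd p)"
    proof
      fix z assume z: "z \<in> U"
      obtain x y where [simp]: "z = (x, y)" by fastforce
      have "(x, y) \<in> U" using z by simp
      from openin_prod_topologyE[OF U this]
      obtain V W where VW: "openin S V" "openin T W" "x \<in> V" "y \<in> W" "V \<times> W \<subseteq> U" .
      obtain V' where V': "V' \<in> B" "x \<in> V'" "V' \<subseteq> V" using B(3)[rule_format, OF conjI, OF VW(1,3)] by blast
      obtain W' where W': "W' \<in> D" "y \<in> W'" "W' \<subseteq> W" using D(3)[rule_format, OF conjI, OF VW(2,4)] by blast
      have "V' \<times> W' \<subseteq> U" using V'(3) W'(3) VW(5) by blast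
      then show "z \<in> (\<Union>p\<in>?I. fst p \<times> snd p)"
        using V' W' by (intro UN_I[of "(V', W')"]) auto
    qed
    then have eq: "U = (\<Union>p\<in>?I. fst p \<times> snd p)" by auto
    have "countable ?I" using B(1) D(1) by (auto intro: countable_subset[of _ "B \<times> D"])
    then have "(\<Union>p\<in>?I. fst p \<times> snd p) \<in> sets (borel_of S \<Otimes>\<^sub>M borel_of T)"
      using B(2) D(2) by (intro sets.countable_UN') (auto intro!: pair_measureI openin_imp_sets_borel_of)
    with eq show ?thesis by simp
  qed
  moreover have "topspace (prod_topology S T) = space (borel_of S \<Otimes>\<^sub>M borel_of T)"
    by (simp add: space_pair_measure)
  ultimately show "sets (borel_of (prod_topology S T)) \<subseteq> sets (borel_of S \<Otimes>\<^sub>M borel_of T)"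
    unfolding sets_borel_of by (metis (no_types, lifting) mem_Collect_eq sets.sigma_sets_subset subsetI)
qed

lemma mm_space_mm_sum:
  assumes Y: "mm_space Y" and Z: "mm_space Z"
  shows "mm_space (mm_sum Y Z)"
proof -
  interpret PY: prob_space "mms_measure Y" by (rule mm_spaceD(1)[OF Y])
  interpret PZ: prob_space "mms_measure Z" by (rule mm_spaceD(1)[OF Z])
  interpret P: pair_prob_space "mms_measure Y" "mms_measure Z" ..
  note sep = mm_spaceD(4)[OF Y] mm_spaceD(4)[OF Z]
  have "sets (mms_measure Y \<Otimes>\<^sub>M mms_measure Z) =
      sets (borel_of (mtopology_of (mms_metric Y)) \<Otimes>\<^sub>M borel_of (mtopology_of (mms_metric Z)))"
    by (rule sets_pair_measure_cong[OF mm_spaceD(2)[OF Y] mm_spaceD(2)[OF Z]])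
  also have "\<dots> = sets (borel_of (mtopology_of (sum_metric (mms_metric Y) (mms_metric Z))))"
    unfolding mtopology_of_sum_metric
    by (intro sets_borel_of_prod_topology separable_imp_second_countable sep)
  finally have sets: "sets (mms_measure Y \<Otimes>\<^sub>M mms_measure Z) = \<dots>" .
  have "full_support (mtopology_of (sum_metric (mms_metric Y) (mms_metric Z)))
      (mms_measure Y \<Otimes>\<^sub>M mms_measure Z)"
    unfolding full_support_def
  proof (intro allI impI, elim conjE)
    fix U assume U: "openin (mtopology_of (sum_metric (mms_metric Y) (mms_metric Z))) U" "U \<noteq> {}"
    then obtain x y where xy: "(x, y) \<in> U" by fast
    from openin_prod_topologyE[OF U(1)[unfolded mtopology_of_sum_metric] xy] obtain V W where VW: "openin (mtopology_of (mms_metric Y)) V"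
      "openin (mtopology_of (mms_metric Z)) W" "x \<in> V" "y \<in> W" "V \<times> W \<subseteq> U" .
    have pos: "0 < measure (mms_measure Y) V" "0 < measure (mms_measure Z) W"
      using Y Z VW unfolding mm_space_def full_support_def by auto
    have meas: "V \<in> sets (mms_measure Y)" "W \<in> sets (mms_measure Z)"
      unfolding mm_spaceD(2)[OF Y] mm_spaceD(2)[OF Z] by (intro openin_imp_sets_borel_of VW)+
    have U': "U \<in> sets (mms_measure Y \<Otimes>\<^sub>M mms_measure Z)"
      unfolding sets by (rule openin_imp_sets_borel_of[OF U(1)])
    have "0 < measure (mms_measure Y) V * measure (mms_measure Z) W"
      using pos by simp
    also have "\<dots> = measure (mms_measure Y \<Otimes>\<^sub>M mms_measure Z) (V \<times> W)"
      unfolding measure_def PZ.emeasure_pair_measure_Times[OF meas] by (simp add: enn2real_mult)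
    also have "\<dots> \<le> measure (mms_measure Y \<Otimes>\<^sub>M mms_measure Z) U"
      by (rule P.finite_measure_mono[OF VW(5) U'])
    finally show "0 < measure (mms_measure Y \<Otimes>\<^sub>M mms_measure Z) U" .
  qed
  with sets show ?thesis
    using Y Z P.prob_space_axioms
    unfolding mm_space_def mm_sum_def mms.sel
    by (intro conjI mcomplete_of_sum_metric separable_space_sum_metric) simp_all
qed


definition image_metric :: "('a \<Rightarrow> 'b) \<Rightarrow> 'a metric \<Rightarrow> 'b metric"
  where "image_metric h m = metric (h ` mspace m,
    \<lambda>a b. mdist m (inv_into (mspace m) h a) (inv_into (mspace m) h b))"

lemma image_metric:
  assumes h: "inj_on h (mspace m)"
  shows "mspace (image_metric h m) = h ` mspace m"
    and "isometric_embedding m (image_metric h m) h"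
proof -
  interpret Metric_space "h ` mspace m"
    "\<lambda>a b. mdist m (inv_into (mspace m) h a) (inv_into (mspace m) h b)"
  proof
    fix x y z assume "x \<in> h ` mspace m" "y \<in> h ` mspace m" "z \<in> h ` mspace m"
    then show "mdist m (inv_into (mspace m) h x) (inv_into (mspace m) h z) \<le>
      mdist m (inv_into (mspace m) h x) (inv_into (mspace m) h y) +
      mdist m (inv_into (mspace m) h y) (inv_into (mspace m) h z)"
      by (intro mdist_triangle inv_into_into)
  next
    fix x y assume xy: "x \<in> h ` mspace m" "y \<in> h ` mspace m"
    then show "(mdist m (inv_into (mspace m) h x) (inv_into (mspace m) h y) = 0) \<longleftrightarrow> (x = y)"
      using inv_into_injective[of "mspace m" h x y] by (auto simp: inv_into_into)
  qed (simp_all add: mdist_commute)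
  show 1: "mspace (image_metric h m) = h ` mspace m"
    unfolding image_metric_def by (rule mspace_metric)
  show "isometric_embedding m (image_metric h m) h"
    unfolding isometric_embedding_def 1
    unfolding image_metric_def mdist_metric using h by simp
qed

lemma separable_imp_inj_point:
  assumes "separable_space (mtopology_of m)"
  obtains h :: "'a \<Rightarrow> point" where "inj_on h (mspace (m :: 'a metric))"
proof -
  obtain C where C: "countable C" "C \<subseteq> mspace m" "\<And>x r. x \<in> mspace m \<Longrightarrow> r > 0 \<Longrightarrow> \<exists>c\<in>C. mdist m x c < r"
    by (rule separable_spaceE[OF assms]) (erule that, assumption, blast)
  have "inj_on (\<lambda>x n. mdist m x (from_nat_into C n)) (mspace m)"
  proof (rule inj_onI, rule ccontr)
    fix x y assume xy: "x \<in> mspace m" "y \<in> mspace m" "x \<noteq> y"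
      and eq: "(\<lambda>n. mdist m x (from_nat_into C n)) = (\<lambda>n. mdist m y (from_nat_into C n))"
    have pos: "mdist m x y > 0"
      using xy mdist_zero[of x m y] mdist_nonneg[of m x y] by linarith
    obtain c where c: "c \<in> C" "mdist m x c < mdist m x y / 2"
      using C(3)[OF xy(1), of "mdist m x y / 2"] pos by auto
    obtain n where n: "c = from_nat_into C n"
      using from_nat_into_surj[OF C(1) c(1)] by metis
    have "mdist m y c = mdist m x c"
      using fun_cong[OF eq, of n] n by simp
    moreover have "mdist m x y \<le> mdist m x c + mdist m c y"
      using xy c(1) C(2) by (intro mdist_triangle) auto
    ultimately show False
      using c(2) by (simp add: mdist_commute)
  qed
  then show ?thesis by (rule that)
qed

lemma mm_space_image:
  assumes X: "mm_space X" and h: "isometric_embedding (mms_metric X) m' h" "h ` pts X = mspace m'"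
  defines "W \<equiv> Mms m' (distr (mms_measure X) (borel_of (mtopology_of m')) h)"
  shows "mm_space W" and "mm_iso X W"
proof -
  interpret P: prob_space "mms_measure X" by (rule mm_spaceD(1)[OF X])
  interpret A: Metric_space "pts X" "mdst X" by (rule Metric_space_mspace_mdist)
  interpret B: Metric_space "mspace m'" "mdist m'" by (rule Metric_space_mspace_mdist)
  have cont: "continuous_map (mtopology_of (mms_metric X)) (mtopology_of m') h"
    by (rule isometric_embedding_continuous[OF h(1)])
  have meas: "h \<in> mms_measure X \<rightarrow>\<^sub>M borel_of (mtopology_of m')"
    using isometric_embedding_measurable[OF h(1)]
    by (simp add: measurable_cong_sets[OF mm_spaceD(2)[OF X] refl])
  let ?g = "inv_into (pts X) h"
  have g: "isometric_embedding m' (mms_metric X) ?g"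
    by (rule isometric_embedding_inv[OF h])
  have "mcomplete_of m'"
    unfolding mcomplete_of_def B.mcomplete_def
  proof (intro allI impI)
    fix \<sigma> assume \<sigma>: "B.MCauchy \<sigma>"
    have \<sigma>in: "\<sigma> n \<in> mspace m'" for n using \<sigma> unfolding B.MCauchy_def by blast
    have eq: "mdst X (?g (\<sigma> n)) (?g (\<sigma> k)) = mdist m' (\<sigma> n) (\<sigma> k)" for n k
      using g \<sigma>in unfolding isometric_embedding_def by blast
    have gin: "?g (\<sigma> n) \<in> pts X" for n
      using g \<sigma>in unfolding isometric_embedding_def by blast
    have "A.MCauchy (?g \<circ> \<sigma>)"
      using \<sigma> gin unfolding A.MCauchy_def B.MCauchy_def o_def eq by blast
    then obtain x where "limitin A.mtopology (?g \<circ> \<sigma>) x sequentially"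
      using X unfolding mm_space_def mcomplete_of_def A.mcomplete_def by blast
    then have "limitin (mtopology_of m') (h \<circ> (?g \<circ> \<sigma>)) (h x) sequentially"
      by (intro continuous_map_limit[OF cont]) (simp add: mtopology_of_def)
    moreover have "h \<circ> (?g \<circ> \<sigma>) = \<sigma>"
      using \<sigma>in h(2) by (auto simp: f_inv_into_f)
    ultimately show "\<exists>x. limitin B.mtopology \<sigma> x sequentially"
      unfolding mtopology_of_def by auto
  qed
  moreover have "separable_space (mtopology_of m')"
    using separable_space_continuous_map_image[OF _ cont] X h(2) unfolding mm_space_def by simp
  moreover have "prob_space (distr (mms_measure X) (borel_of (mtopology_of m')) h)"
    by (rule P.prob_space_distr[OF meas])
  moreover have "full_support (mtopology_of m') (distr (mms_measure X) (borel_of (mtopology_of m')) h)"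
    unfolding full_support_def
  proof (intro allI impI, elim conjE)
    fix U assume U: "openin (mtopology_of m') U" "U \<noteq> {}"
    let ?V = "{x \<in> pts X. h x \<in> U}"
    have "openin (mtopology_of (mms_metric X)) ?V"
      using openin_continuous_map_preimage[OF cont U(1)] by simp
    moreover have "?V \<noteq> {}"
    proof -
      obtain u where u: "u \<in> U" using U(2) by blast
      then have "u \<in> h ` pts X" using openin_subset[OF U(1)] h(2) by auto
      then show ?thesis using u by blast
    qed
    ultimately have "0 < measure (mms_measure X) ?V"
      using X unfolding mm_space_def full_support_def by blast
    moreover have "h -` U \<inter> space (mms_measure X) = ?V"
      unfolding mm_spaceD(3)[OF X] by blast
    ultimately show "0 < measure (distr (mms_measure X) (borel_of (mtopology_of m')) h) U"
      by (simp add: measure_distr[OF meas openin_imp_sets_borel_of[OF U(1)]])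
  qed
  ultimately show "mm_space W"
    unfolding W_def mm_space_def by simp
  show "mm_iso X W"
    unfolding mm_iso_def W_def mms.sel
    using h by (intro exI[of _ h] conjI distr_cong) simp_all
qed

lemma mm_space_copy:
  assumes "mm_space X"
  shows "\<exists>W :: point mms. mm_space W \<and> mm_iso X W"
proof -
  have sep: "separable_space (mtopology_of (mms_metric X))"
    using assms unfolding mm_space_def by blast
  obtain h :: "_ \<Rightarrow> point" where h: "inj_on h (pts X)"
    by (rule separable_imp_inj_point[OF sep])
  show ?thesis
    using mm_space_image[OF assms image_metric(2)[OF h] image_metric(1)[OF h, symmetric]] by blast
qed

lemma rep_mm: "mm_space (rep_mm A)"
  using Quotient3_rep_reflp[OF Quotient3_mm, of A] by blast

lemma rep_mm_class:
  assumes "mm_space X"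
  shows "mm_iso X (rep_mm (mm_class X))"
proof -
  define W :: "point mms" where "W = (SOME W. mm_space W \<and> mm_iso X W)"
  have W: "mm_space W" "mm_iso X W"
    using someI_ex[OF mm_space_copy[OF assms]] unfolding W_def by blast+
  have "mm_iso W (rep_mm (abs_mm W))"
    using rep_abs_rsp[OF Quotient3_mm, of W W] W(1) mm_iso_refl by blast
  then show ?thesis
    unfolding mm_class_def W_def[symmetric]
    by (rule mm_iso_trans[OF assms W(1) rep_mm W(2)])
qed

lemma mm_class_eq_iff:
  assumes "mm_space X" "mm_space Y"
  shows "mm_class X = mm_class Y \<longleftrightarrow> mm_iso X Y"
proof
  assume "mm_class X = mm_class Y"
  then show "mm_iso X Y"
    using rep_mm_class[OF assms(1)] mm_iso_sym[OF assms(2) rep_mm rep_mm_class[OF assms(2)]]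
    by (metis mm_iso_trans[OF assms(1) rep_mm assms(2)])
next
  assume iso: "mm_iso X Y"
  have "mm_iso (rep_mm (mm_class X)) (rep_mm (mm_class Y))"
    by (rule mm_iso_trans[OF rep_mm assms(1) rep_mm mm_iso_sym[OF assms(1) rep_mm rep_mm_class[OF assms(1)]]
          mm_iso_trans[OF assms rep_mm iso rep_mm_class[OF assms(2)]]])
  then show "mm_class X = mm_class Y"
    using Quotient3_rel_rep[OF Quotient3_mm, of "mm_class X" "mm_class Y"] rep_mm by blast
qed

lemma mm_class_rep_mm: "mm_class (rep_mm A) = A"
  using Quotient3_rel_rep[OF Quotient3_mm, of "mm_class (rep_mm A)" A] rep_mm
    mm_iso_sym[OF rep_mm rep_mm rep_mm_class[OF rep_mm]] by blast

lemma gpr_mm_class: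
  assumes "mm_space X" "mm_space Y"
  shows "gpr (mm_class X) (mm_class Y) = gpr_dist X Y"
proof -
  have "gpr (mm_class X) (mm_class Y) = gpr_dist (rep_mm (mm_class X)) (rep_mm (mm_class Y))"
    by (simp add: gpr_def)
  also have "\<dots> = gpr_dist X Y"
    by (rule gpr_dist_cong[OF assms(1) rep_mm assms(2) rep_mm rep_mm_class[OF assms(1)]
          rep_mm_class[OF assms(2)], symmetric])
  finally show ?thesis .
qed

lemma mm_iso_mm_sum:
  assumes X: "mm_space X" "mm_space X'" "mm_iso X X'" and Y: "mm_space Y" "mm_space Y'" "mm_iso Y Y'"
  shows "mm_iso (mm_sum X Y) (mm_sum X' Y')"
proof -
  obtain f where f: "isometric_embedding (mms_metric X) (mms_metric X') f" "f ` pts X = pts X'"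
    "distr (mms_measure X) (mms_measure X') f = mms_measure X'"
    using X(3) unfolding mm_iso_def by blast
  obtain g where g: "isometric_embedding (mms_metric Y) (mms_metric Y') g" "g ` pts Y = pts Y'"
    "distr (mms_measure Y) (mms_measure Y') g = mms_measure Y'"
    using Y(3) unfolding mm_iso_def by blast
  interpret PY: prob_space "mms_measure Y'" by (rule mm_spaceD(1)[OF Y(2)])
  have "sigma_finite_measure (mms_measure Y')" ..
  then have "mms_measure X' \<Otimes>\<^sub>M mms_measure Y' = distr (mms_measure X \<Otimes>\<^sub>M mms_measure Y)
      (mms_measure X' \<Otimes>\<^sub>M mms_measure Y') (\<lambda>(x, y). (f x, g y))"
    using pair_measure_distr[of f "mms_measure X" "mms_measure X'" g "mms_measure Y" "mms_measure Y'"]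
      isometric_embedding_measurable[OF f(1)] isometric_embedding_measurable[OF g(1)]
    by (simp add: f(3) g(3) measurable_cong_sets[OF mm_spaceD(2)[OF X(1)] mm_spaceD(2)[OF X(2)]]
        measurable_cong_sets[OF mm_spaceD(2)[OF Y(1)] mm_spaceD(2)[OF Y(2)]])
  moreover have "isometric_embedding (sum_metric (mms_metric X) (mms_metric Y))
      (sum_metric (mms_metric X') (mms_metric Y')) (\<lambda>(x, y). (f x, g y))"
    using f(1) g(1) unfolding isometric_embedding_def by fastforce
  moreover have "(\<lambda>(x, y). (f x, g y)) ` (pts X \<times> pts Y) = pts X' \<times> pts Y'"
    unfolding f(2)[symmetric] g(2)[symmetric] by force
  ultimately show ?thesis
    unfolding mm_iso_def mm_sum_def mms.sel mspace_sum_metric by metis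
qed

lemma boxplus_mm_class:
  assumes "mm_space Y" "mm_space Z"
  shows "mm_class Y \<boxplus> mm_class Z = mm_class (mm_sum Y Z)"
  unfolding boxplus_def
  using mm_class_eq_iff[OF mm_space_mm_sum[OF assms] mm_space_mm_sum[OF rep_mm rep_mm]]
    mm_iso_mm_sum[OF assms(1) rep_mm rep_mm_class[OF assms(1)] assms(2) rep_mm rep_mm_class[OF assms(2)]]
  by metis

lemma openin_gpr_topology:
  "openin gpr_topology U \<longleftrightarrow> (\<forall>A\<in>U. \<exists>e>0. \<forall>B. gpr A B < e \<longrightarrow> B \<in> U)"
proof -
  let ?L = "\<lambda>U. \<forall>A\<in>U. \<exists>e>0. \<forall>B. gpr A B < e \<longrightarrow> B \<in> U"
  have "istopology ?L"
    unfolding istopology_def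
  proof (intro conjI allI impI)
    fix S T assume S: "?L S" and T: "?L T"
    show "?L (S \<inter> T)"
    proof
      fix A assume A: "A \<in> S \<inter> T"
      obtain e where "e > 0" "\<forall>B. gpr A B < e \<longrightarrow> B \<in> S" using S A by blast
      moreover obtain e' where "e' > 0" "\<forall>B. gpr A B < e' \<longrightarrow> B \<in> T" using T A by blast
      ultimately show "\<exists>e>0. \<forall>B. gpr A B < e \<longrightarrow> B \<in> S \<inter> T"
        by (intro exI[of _ "min e e'"]) simp
    qed
  next
    fix K assume K: "\<forall>S\<in>K. ?L S"
    show "?L (\<Union>K)"
    proof
      fix A assume "A \<in> \<Union>K"
      then obtain S where S: "S \<in> K" "A \<in> S" by blast
      obtain e where "e > 0" "\<forall>B. gpr A B < e \<longrightarrow> B \<in> S" using K S by blast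
      then show "\<exists>e>0. \<forall>B. gpr A B < e \<longrightarrow> B \<in> \<Union>K"
        using S(1) by blast
    qed
  qed
  then show ?thesis
    unfolding gpr_topology_def by (simp only: topology_inverse')
qed

lemma isometric_embedding_mm_measurable:
  assumes "mm_space X" "isometric_embedding (mms_metric X) m f"
  shows "f \<in> mms_measure X \<rightarrow>\<^sub>M borel_of (mtopology_of m)"
  using isometric_embedding_measurable[OF assms(2)]
  by (simp add: measurable_cong_sets[OF mm_spaceD(2)[OF assms(1)] refl])

lemma openin_enlargement:
  assumes "F \<subseteq> mspace m"
  shows "openin (mtopology_of m) (enlargement m F \<epsilon>)"
proof -
  have "enlargement m F \<epsilon> = (\<Union>x\<in>F. {y \<in> mspace m. mdist m x y < \<epsilon>})"
    unfolding enlargement_def by (auto simp: mdist_commute)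
  then show ?thesis using assms by (auto intro!: openin_ball_of)
qed

lemma closedin_imp_sets_borel_of: "closedin T F \<Longrightarrow> F \<in> sets (borel_of T)"
  using sets.compl_sets[of "topspace T - F" "borel_of T"] openin_imp_sets_borel_of[of T "topspace T - F"]
  by (simp add: closedin_def double_diff)

lemma prohorov_nonneg:
  assumes "prob_space \<mu>"
  shows "0 \<le> prohorov m \<mu> \<nu>"
proof -
  have "measure \<mu> F \<le> 1" for F using prob_space.prob_le_1[OF assms] .
  then have "{\<epsilon>. 0 < \<epsilon> \<and> (\<forall>F. closedin (mtopology_of m) F \<longrightarrow>
      measure \<mu> F \<le> measure \<nu> (enlargement m F \<epsilon>) + \<epsilon>)} \<noteq> {}"
    by (auto intro!: exI[of _ 1] add_increasing)
  then show ?thesis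
    unfolding prohorov_def by (rule cInf_greatest) simp
qed

lemma gpr_dist_le:
  fixes X :: "'a mms" and Y :: "'b mms" and Z :: "'c metric"
  assumes X: "mm_space X" and Y: "mm_space Y"
    and \<phi>: "isometric_embedding (mms_metric X) Z \<phi>" and \<psi>: "isometric_embedding (mms_metric Y) Z \<psi>"
  shows "gpr_dist X Y \<le> prohorov Z (distr (mms_measure X) (borel_of (mtopology_of Z)) \<phi>)
                                   (distr (mms_measure Y) (borel_of (mtopology_of Z)) \<psi>)"
proof -
  define S where "S = \<phi> ` pts X \<union> \<psi> ` pts Y"
  have S: "S \<subseteq> mspace Z"
    using \<phi> \<psi> unfolding S_def isometric_embedding_def by auto
  have msp: "mspace (submetric Z S) = S" using S by auto
  have \<phi>S: "isometric_embedding (mms_metric X) (submetric Z S) \<phi>"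
    and \<psi>S: "isometric_embedding (mms_metric Y) (submetric Z S) \<psi>"
    using \<phi> \<psi> unfolding isometric_embedding_def msp by (auto simp: S_def)
  have sep: "separable_space (mtopology_of (submetric Z S))"
  proof -
    obtain C where C: "countable C" "C \<subseteq> pts X" "\<And>x r. x \<in> pts X \<Longrightarrow> r > 0 \<Longrightarrow> \<exists>c\<in>C. mdst X x c < r"
      by (rule separable_spaceE[OF mm_spaceD(4)[OF X]]) (erule that, assumption, blast)
    obtain D where D: "countable D" "D \<subseteq> pts Y" "\<And>x r. x \<in> pts Y \<Longrightarrow> r > 0 \<Longrightarrow> \<exists>c\<in>D. mdst Y x c < r"
      by (rule separable_spaceE[OF mm_spaceD(4)[OF Y]]) (erule that, assumption, blast)
    have 1: "\<exists>c\<in>\<phi> ` C \<union> \<psi> ` D. mdist Z (\<phi> x) c < r" if x: "x \<in> pts X" "r > 0" for x r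
    proof -
      obtain c where c: "c \<in> C" "mdst X x c < r" using C(3)[OF x] by blast
      then have "mdist Z (\<phi> x) (\<phi> c) < r"
        using \<phi> x(1) C(2) unfolding isometric_embedding_def by (metis subsetD)
      then show ?thesis using c(1) by blast
    qed
    have 2: "\<exists>c\<in>\<phi> ` C \<union> \<psi> ` D. mdist Z (\<psi> x) c < r" if x: "x \<in> pts Y" "r > 0" for x r
    proof -
      obtain c where c: "c \<in> D" "mdst Y x c < r" using D(3)[OF x] by blast
      then have "mdist Z (\<psi> x) (\<psi> c) < r"
        using \<psi> x(1) D(2) unfolding isometric_embedding_def by (metis subsetD)
      then show ?thesis using c(1) by blast
    qed
    show ?thesis
      unfolding separable_space_mtopology_of_iff msp mdist_submetric
    proof (intro exI[of _ "\<phi> ` C \<union> \<psi> ` D"] conjI ballI allI impI)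
      show "countable (\<phi> ` C \<union> \<psi> ` D)" using C(1) D(1) by simp
      show "\<phi> ` C \<union> \<psi> ` D \<subseteq> S" using C(2) D(2) unfolding S_def by blast
      fix s and r :: real assume "s \<in> S" "r > 0"
      then show "\<exists>c\<in>\<phi> ` C \<union> \<psi> ` D. mdist Z s c < r"
        unfolding S_def using 1 2 by auto
    qed
  qed
  obtain h :: "'c \<Rightarrow> point" where h: "inj_on h S"
    using separable_imp_inj_point[OF sep] unfolding msp by blast
  define Z' where "Z' = image_metric h (submetric Z S)"
  have Z': "mspace Z' = h ` S" and hZ: "isometric_embedding (submetric Z S) Z' h"
    using image_metric[of h "submetric Z S"] h unfolding msp Z'_def by auto
  have hd: "mdist Z' (h s) (h t) = mdist Z s t" if "s \<in> S" "t \<in> S" for s t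
    using hZ that unfolding isometric_embedding_def msp mdist_submetric by blast
  let ?\<phi>' = "h \<circ> \<phi>" and ?\<psi>' = "h \<circ> \<psi>"
  have \<phi>': "isometric_embedding (mms_metric X) Z' ?\<phi>'" and \<psi>': "isometric_embedding (mms_metric Y) Z' ?\<psi>'"
    by (rule isometric_embedding_comp[OF \<phi>S hZ], rule isometric_embedding_comp[OF \<psi>S hZ])
  let ?M = "\<lambda>M Z \<phi>. distr M (borel_of (mtopology_of Z)) \<phi>"
  interpret PX: prob_space "mms_measure X" by (rule mm_spaceD(1)[OF X])
  interpret PY: prob_space "mms_measure Y" by (rule mm_spaceD(1)[OF Y])
  have le: "prohorov Z' (?M (mms_measure X) Z' ?\<phi>') (?M (mms_measure Y) Z' ?\<psi>') \<le>
      prohorov Z (?M (mms_measure X) Z \<phi>) (?M (mms_measure Y) Z \<psi>)"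
    unfolding prohorov_def
  proof (rule cInf_superset_mono)
    have "measure (?M (mms_measure X) Z \<phi>) F \<le> 1" for F
      using prob_space.prob_le_1[OF PX.prob_space_distr[OF isometric_embedding_mm_measurable[OF X \<phi>]]] .
    then show "{\<epsilon>. 0 < \<epsilon> \<and> (\<forall>F. closedin (mtopology_of Z) F \<longrightarrow> measure (?M (mms_measure X) Z \<phi>) F
        \<le> measure (?M (mms_measure Y) Z \<psi>) (enlargement Z F \<epsilon>) + \<epsilon>)} \<noteq> {}"
      by (auto intro!: exI[of _ 1] add_increasing)
    show "bdd_below {\<epsilon>. 0 < \<epsilon> \<and> (\<forall>F. closedin (mtopology_of Z') F \<longrightarrow> measure (?M (mms_measure X) Z' ?\<phi>') F
        \<le> measure (?M (mms_measure Y) Z' ?\<psi>') (enlargement Z' F \<epsilon>) + \<epsilon>)}"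
      by (rule bdd_belowI[of _ 0]) simp
    show "{\<epsilon>. 0 < \<epsilon> \<and> (\<forall>F. closedin (mtopology_of Z) F \<longrightarrow> measure (?M (mms_measure X) Z \<phi>) F
        \<le> measure (?M (mms_measure Y) Z \<psi>) (enlargement Z F \<epsilon>) + \<epsilon>)} \<subseteq>
      {\<epsilon>. 0 < \<epsilon> \<and> (\<forall>F. closedin (mtopology_of Z') F \<longrightarrow> measure (?M (mms_measure X) Z' ?\<phi>') F
        \<le> measure (?M (mms_measure Y) Z' ?\<psi>') (enlargement Z' F \<epsilon>) + \<epsilon>)}"
    proof (intro subsetI CollectI conjI allI impI; elim CollectE conjE)
      fix \<epsilon> :: real and F' assume \<epsilon>: "0 < \<epsilon>" and F': "closedin (mtopology_of Z') F'"
        and *: "\<forall>F. closedin (mtopology_of Z) F \<longrightarrow> measure (?M (mms_measure X) Z \<phi>) F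
          \<le> measure (?M (mms_measure Y) Z \<psi>) (enlargement Z F \<epsilon>) + \<epsilon>"
      define G where "G = {s \<in> S. h s \<in> F'}"
      define F where "F = mtopology_of Z closure_of G"
      have F'sub: "F' \<subseteq> h ` S" using closedin_subset[OF F'] Z' by simp
      have GS: "G \<subseteq> S" unfolding G_def by blast
      have clF: "closedin (mtopology_of Z) F" unfolding F_def by simp
      have Fs: "F \<subseteq> mspace Z" using closedin_subset[OF clF] by simp
      have Fiff: "s \<in> F \<longleftrightarrow> h s \<in> F'" if s: "s \<in> S" for s
      proof -
        have "s \<in> F \<longleftrightarrow> (\<forall>r>0. \<exists>t\<in>G. mdist Z s t < r)"
          unfolding F_def closure_of_mtopology_of_iff using s S GS by (metis Int_absorb2 subset_eq)
        also have "\<dots> \<longleftrightarrow> (\<forall>r>0. \<exists>b\<in>F'. mdist Z' (h s) b < r)"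
        proof -
          have "(\<exists>t\<in>G. mdist Z s t < r) \<longleftrightarrow> (\<exists>b\<in>F'. mdist Z' (h s) b < r)" for r
          proof
            assume "\<exists>t\<in>G. mdist Z s t < r"
            then obtain t where t: "t \<in> S" "h t \<in> F'" "mdist Z s t < r" unfolding G_def by blast
            then have "mdist Z' (h s) (h t) < r" using hd[OF s t(1)] by simp
            then show "\<exists>b\<in>F'. mdist Z' (h s) b < r" using t(2) by blast
          next
            assume "\<exists>b\<in>F'. mdist Z' (h s) b < r"
            then obtain b where b: "b \<in> F'" "mdist Z' (h s) b < r" by blast
            then obtain t where t: "t \<in> S" "b = h t" using F'sub by blast
            then have "mdist Z s t < r" "t \<in> G" using hd[OF s t(1)] b unfolding G_def by auto
            then show "\<exists>t\<in>G. mdist Z s t < r" by blast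
          qed
          then show ?thesis by simp
        qed
        also have "\<dots> \<longleftrightarrow> h s \<in> mtopology_of Z' closure_of F'"
        proof -
          have "F' \<inter> mspace Z' = F'" "h s \<in> mspace Z'" using F'sub Z' s by auto
          then show ?thesis unfolding closure_of_mtopology_of_iff by simp
        qed
        also have "\<dots> \<longleftrightarrow> h s \<in> F'" using F' by (simp add: closure_of_closedin)
        finally show ?thesis .
      qed
      have Eiff: "s \<in> enlargement Z F \<epsilon> \<longleftrightarrow> h s \<in> enlargement Z' F' \<epsilon>" if s: "s \<in> S" for s
      proof
        assume "s \<in> enlargement Z F \<epsilon>"
        then obtain z where z: "z \<in> F" "mdist Z s z < \<epsilon>" unfolding enlargement_def by blast
        then have "\<exists>t\<in>G \<inter> mspace Z. mdist Z z t < \<epsilon> - mdist Z s z"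
          unfolding F_def closure_of_mtopology_of_iff by simp
        then obtain t where t: "t \<in> G" "mdist Z z t < \<epsilon> - mdist Z s z" by blast
        have "mdist Z s t \<le> mdist Z s z + mdist Z z t"
          using s t(1) z(1) S GS Fs by (intro mdist_triangle) auto
        then have "mdist Z' (h s) (h t) < \<epsilon>" using hd[OF s, of t] t GS by auto
        then show "h s \<in> enlargement Z' F' \<epsilon>"
          unfolding enlargement_def Z' using s t(1) unfolding G_def by blast
      next
        assume "h s \<in> enlargement Z' F' \<epsilon>"
        then obtain b where b: "b \<in> F'" "mdist Z' (h s) b < \<epsilon>" unfolding enlargement_def by blast
        then obtain t where t: "t \<in> S" "b = h t" using F'sub by blast
        have "t \<in> F" using Fiff[OF t(1)] b t by simp
        moreover have "mdist Z s t < \<epsilon>" using hd[OF s t(1)] b t by simp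
        ultimately show "s \<in> enlargement Z F \<epsilon>"
          unfolding enlargement_def using s S by blast
      qed
      have inS: "\<phi> x \<in> S" if "x \<in> pts X" for x using that unfolding S_def by blast
      have inS': "\<psi> y \<in> S" if "y \<in> pts Y" for y using that unfolding S_def by blast
      have mF: "F \<in> sets (borel_of (mtopology_of Z))" "F' \<in> sets (borel_of (mtopology_of Z'))"
        using clF F' by (auto intro: closedin_imp_sets_borel_of)
      have mE: "enlargement Z F \<epsilon> \<in> sets (borel_of (mtopology_of Z))"
        "enlargement Z' F' \<epsilon> \<in> sets (borel_of (mtopology_of Z'))"
        using openin_enlargement[OF Fs] openin_enlargement[of F' Z'] F'sub Z'
        by (auto intro: openin_imp_sets_borel_of)
      have "measure (?M (mms_measure X) Z' ?\<phi>') F' = measure (?M (mms_measure X) Z \<phi>) F"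
        unfolding measure_distr[OF isometric_embedding_mm_measurable[OF X \<phi>] mF(1)]
          measure_distr[OF isometric_embedding_mm_measurable[OF X \<phi>'] mF(2)] mm_spaceD(3)[OF X]
        using Fiff inS by (intro arg_cong[where f = "measure (mms_measure X)"]) auto
      moreover have "measure (?M (mms_measure Y) Z' ?\<psi>') (enlargement Z' F' \<epsilon>) =
          measure (?M (mms_measure Y) Z \<psi>) (enlargement Z F \<epsilon>)"
        unfolding measure_distr[OF isometric_embedding_mm_measurable[OF Y \<psi>] mE(1)]
          measure_distr[OF isometric_embedding_mm_measurable[OF Y \<psi>'] mE(2)] mm_spaceD(3)[OF Y]
        using Eiff inS' by (intro arg_cong[where f = "measure (mms_measure Y)"]) auto
      ultimately show "measure (?M (mms_measure X) Z' ?\<phi>') F'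
          \<le> measure (?M (mms_measure Y) Z' ?\<psi>') (enlargement Z' F' \<epsilon>) + \<epsilon>"
        using * clF by simp
    qed
  qed
  have "gpr_dist X Y \<le> prohorov Z' (?M (mms_measure X) Z' ?\<phi>') (?M (mms_measure Y) Z' ?\<psi>')"
    unfolding gpr_dist_def
  proof (rule cInf_lower)
    show "bdd_below {prohorov Z (?M (mms_measure X) Z \<phi>) (?M (mms_measure Y) Z \<psi>)
         | (Z :: point metric) \<phi> \<psi>.
           isometric_embedding (mms_metric X) Z \<phi> \<and> isometric_embedding (mms_metric Y) Z \<psi>}"
      by (rule bdd_belowI[of _ 0])
         (auto intro!: prohorov_nonneg PX.prob_space_distr isometric_embedding_mm_measurable[OF X])
  qed (use \<phi>' \<psi>' in blast)
  with le show ?thesis by linarith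
qed

end

theory Submission
  imports Defs
begin

text \<open>
  The inequality. Let \<open>X\<^sub>1\<close>, \<open>Y\<^sub>1\<close> be embedded in \<open>Z\<^sub>1\<close> and \<open>X\<^sub>2\<close>, \<open>Y\<^sub>2\<close> in \<open>Z\<^sub>2\<close> so that the image
  laws are within Prohorov distance \<open>\<epsilon>\<^sub>1\<close> and \<open>\<epsilon>\<^sub>2\<close>. The products \<open>X\<^sub>1 \<boxplus> X\<^sub>2\<close> and \<open>Y\<^sub>1 \<boxplus> Y\<^sub>2\<close> both embed in the
  \<open>\<ell>\<^sup>1\<close>-product of \<open>Z\<^sub>1\<close> and \<open>Z\<^sub>2\<close>, and there one passes from \<open>\<mu>\<^sub>1 \<otimes> \<mu>\<^sub>2\<close> to \<open>\<nu>\<^sub>1 \<otimes> \<nu>\<^sub>2\<close> by exchanging one factor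
  at a time. Exchanging \<open>\<mu>\<^sub>1\<close> for \<open>\<nu>\<^sub>1\<close> costs at most \<open>\<epsilon>\<^sub>1\<close>: every section of a closed set is closed, the
  Prohorov condition holds for each section, and by Fubini integration over the other factor
  preserves it (\<open>prohorov_within_law_sum_fst\<close>). The other factor is treated by swapping coordinates
  (\<open>prohorov_within_law_sum_snd\<close>), and the triangle inequality of the Prohorov distance on a fixed
  space (\<open>prohorov_within_trans\<close>) adds the two costs.

  Continuity. By the inequality, the product of the balls of radius \<open>e / 2\<close> around \<open>A\<close> and \<open>B\<close> is mapped
  into the ball of radius \<open>e\<close> around \<open>A \<boxplus> B\<close>. For these balls to be open neighbourhoods, \<open>gpr\<close> has to
  vanish on the diagonal and to satisfy the triangle inequality (\<open>gpr_dist_triangle\<close>). The latter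
  compares laws in two different ambient spaces, both of which contain a copy of the middle space
  \<open>Y\<close>; these are glued along \<open>Y\<close> into one ambient space (\<open>glued_metric\<close>).
\<close>

section \<open>Image laws and the Prohorov condition\<close>

abbreviation law :: "'a mms \<Rightarrow> 'b metric \<Rightarrow> ('a \<Rightarrow> 'b) \<Rightarrow> 'b measure"
  where "law X m \<phi> \<equiv> distr (mms_measure X) (borel_of (mtopology_of m)) \<phi>"

text \<open>
  The condition under the infimum in \<open>prohorov\<close>. The whole argument runs on this condition, and the
  infimum is taken only at the end.
\<close>

definition prohorov_within :: "'a metric \<Rightarrow> 'a measure \<Rightarrow> 'a measure \<Rightarrow> real \<Rightarrow> bool"
  where "prohorov_within m \<mu> \<nu> \<epsilon> \<longleftrightarrow> 0 < \<epsilon> \<and>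
    (\<forall>F. closedin (mtopology_of m) F \<longrightarrow> measure \<mu> F \<le> measure \<nu> (enlargement m F \<epsilon>) + \<epsilon>)"

lemma prohorov_eq_Inf_within: "prohorov m \<mu> \<nu> = Inf {\<epsilon>. prohorov_within m \<mu> \<nu> \<epsilon>}"
  unfolding prohorov_def prohorov_within_def ..

lemma prob_space_law:
  assumes "mm_space X" "isometric_embedding (mms_metric X) m \<phi>"
  shows "prob_space (law X m \<phi>)"
  using prob_space.prob_space_distr[OF mm_spaceD(1) isometric_embedding_mm_measurable] assms
  by blast

lemma measure_law:
  assumes "mm_space X" "isometric_embedding (mms_metric X) m \<phi>"
    and "A \<in> sets (borel_of (mtopology_of m))"
  shows "measure (law X m \<phi>) A = measure (mms_measure X) {x \<in> pts X. \<phi> x \<in> A}"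
  using measure_distr[OF isometric_embedding_mm_measurable[OF assms(1,2)] assms(3)]
  by (simp add: mm_spaceD(3)[OF assms(1)] vimage_def Int_def conj_commute)

lemma embedding_preimage_sets:
  assumes "mm_space X" "isometric_embedding (mms_metric X) m \<phi>"
    and "A \<in> sets (borel_of (mtopology_of m))"
  shows "{x \<in> pts X. \<phi> x \<in> A} \<in> sets (mms_measure X)"
  using measurable_sets[OF isometric_embedding_mm_measurable[OF assms(1,2)] assms(3)]
  by (simp add: mm_spaceD(3)[OF assms(1)] vimage_def Int_def conj_commute)

lemma closedin_subset_mspace: "closedin (mtopology_of m) F \<Longrightarrow> F \<subseteq> mspace m"
  using closedin_subset[of "mtopology_of m" F] by simp

lemma enlargement_sets:
  "F \<subseteq> mspace m \<Longrightarrow> enlargement m F \<epsilon> \<in> sets (borel_of (mtopology_of m))"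
  by (rule openin_imp_sets_borel_of[OF openin_enlargement])

lemma enlargement_mono: "\<epsilon> \<le> \<epsilon>' \<Longrightarrow> enlargement m F \<epsilon> \<subseteq> enlargement m F \<epsilon>'"
  unfolding enlargement_def by force

lemma enlargement_closure_enlargement:
  assumes "F \<subseteq> mspace m"
  shows "enlargement m (mtopology_of m closure_of enlargement m F \<epsilon>) \<epsilon>' \<subseteq> enlargement m F (\<epsilon> + \<epsilon>')"
proof
  fix z assume "z \<in> enlargement m (mtopology_of m closure_of enlargement m F \<epsilon>) \<epsilon>'"
  then obtain w where z: "z \<in> mspace m" and w: "w \<in> mtopology_of m closure_of enlargement m F \<epsilon>"
    and zw: "mdist m z w < \<epsilon>'"
    unfolding enlargement_def by blast
  have wm: "w \<in> mspace m" using w unfolding closure_of_mtopology_of_iff by blast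
  have "\<exists>y\<in>enlargement m F \<epsilon> \<inter> mspace m. mdist m w y < \<epsilon>' - mdist m z w"
    using w zw unfolding closure_of_mtopology_of_iff by simp
  then obtain y x where y: "y \<in> mspace m" "mdist m w y < \<epsilon>' - mdist m z w"
    and x: "x \<in> F" "mdist m y x < \<epsilon>"
    unfolding enlargement_def by blast
  have "mdist m z x \<le> mdist m z w + mdist m w x"
    using z wm x assms by (intro mdist_triangle) auto
  moreover have "mdist m w x \<le> mdist m w y + mdist m y x"
    using y wm x assms by (intro mdist_triangle) auto
  ultimately have "mdist m z x < \<epsilon> + \<epsilon>'" using y x by linarith
  then show "z \<in> enlargement m F (\<epsilon> + \<epsilon>')" unfolding enlargement_def using z x by blast
qed

lemma prohorov_within_mono:
  assumes "finite_measure \<nu>" "sets \<nu> = sets (borel_of (mtopology_of m))"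
    and "prohorov_within m \<mu> \<nu> \<epsilon>" "\<epsilon> \<le> \<epsilon>'"
  shows "prohorov_within m \<mu> \<nu> \<epsilon>'"
  unfolding prohorov_within_def
proof (intro conjI allI impI)
  show "0 < \<epsilon>'" using assms(3,4) unfolding prohorov_within_def by simp
  fix F assume F: "closedin (mtopology_of m) F"
  have "measure \<nu> (enlargement m F \<epsilon>) \<le> measure \<nu> (enlargement m F \<epsilon>')"
    using assms(2) enlargement_sets[OF closedin_subset_mspace[OF F]]
    by (intro finite_measure.finite_measure_mono[OF assms(1)] enlargement_mono assms(4)) simp
  then show "measure \<mu> F \<le> measure \<nu> (enlargement m F \<epsilon>') + \<epsilon>'"
    using assms(3,4) F unfolding prohorov_within_def by force
qed

lemma prohorov_less_imp_within:
  assumes "prob_space \<mu>" "finite_measure \<nu>" "sets \<nu> = sets (borel_of (mtopology_of m))"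
    and "prohorov m \<mu> \<nu> < \<epsilon>"
  shows "prohorov_within m \<mu> \<nu> \<epsilon>"
proof -
  have "prohorov_within m \<mu> \<nu> 1"
    unfolding prohorov_within_def
    by (intro conjI allI impI add_increasing prob_space.prob_le_1[OF assms(1)]) simp_all
  then have "{\<epsilon>. prohorov_within m \<mu> \<nu> \<epsilon>} \<noteq> {}" by blast
  then obtain e where "prohorov_within m \<mu> \<nu> e" "e < \<epsilon>"
    using cInf_lessD[OF _ assms(4)[unfolded prohorov_eq_Inf_within]] by blast
  then show ?thesis
    using prohorov_within_mono[OF assms(2,3)] less_imp_le by blast
qed

lemma prohorov_le_if_within: "prohorov_within m \<mu> \<nu> \<epsilon> \<Longrightarrow> prohorov m \<mu> \<nu> \<le> \<epsilon>"
  unfolding prohorov_eq_Inf_within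
proof (rule cInf_lower)
  show "bdd_below {\<epsilon>. prohorov_within m \<mu> \<nu> \<epsilon>}"
    by (rule bdd_belowI[of _ 0]) (simp add: prohorov_within_def)
qed simp

text \<open>
  The second hypothesis can be applied only to a closed set, whereas the first one yields the open
  set \<open>F\<^sup>\<epsilon>\<close>; hence the detour over its closure. This costs nothing, because enlargements are defined by a
  strict inequality, so that a set and its closure have the same ones.
\<close>

lemma prohorov_within_trans:
  assumes "finite_measure \<rho>" "sets \<rho> = sets (borel_of (mtopology_of m))"
    and "finite_measure \<nu>" "sets \<nu> = sets (borel_of (mtopology_of m))"
    and "prohorov_within m \<mu> \<rho> \<epsilon>" "prohorov_within m \<rho> \<nu> \<epsilon>'"
  shows "prohorov_within m \<mu> \<nu> (\<epsilon> + \<epsilon>')"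
  unfolding prohorov_within_def
proof (intro conjI allI impI)
  show "0 < \<epsilon> + \<epsilon>'" using assms(5,6) unfolding prohorov_within_def by simp
  fix F assume F: "closedin (mtopology_of m) F"
  let ?C = "mtopology_of m closure_of enlargement m F \<epsilon>"
  have C: "closedin (mtopology_of m) ?C" by simp
  have sub: "enlargement m F \<epsilon> \<subseteq> ?C"
    by (rule closure_of_subset) (auto simp: enlargement_def)
  have "measure \<mu> F \<le> measure \<rho> (enlargement m F \<epsilon>) + \<epsilon>"
    using assms(5) F unfolding prohorov_within_def by blast
  also have "measure \<rho> (enlargement m F \<epsilon>) \<le> measure \<rho> ?C"
    using assms(2) closedin_imp_sets_borel_of[OF C]
    by (intro finite_measure.finite_measure_mono[OF assms(1)] sub) simp
  also have "\<dots> \<le> measure \<nu> (enlargement m ?C \<epsilon>') + \<epsilon>'"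
    using assms(6) C unfolding prohorov_within_def by blast
  also have "measure \<nu> (enlargement m ?C \<epsilon>') \<le> measure \<nu> (enlargement m F (\<epsilon> + \<epsilon>'))"
    using assms(4) enlargement_sets[OF closedin_subset_mspace[OF F]]
    by (intro finite_measure.finite_measure_mono[OF assms(3)]
        enlargement_closure_enlargement closedin_subset_mspace[OF F]) simp
  finally show "measure \<mu> F \<le> measure \<nu> (enlargement m F (\<epsilon> + \<epsilon>')) + (\<epsilon> + \<epsilon>')" by simp
qed

lemma prohorov_within_law_trans:
  assumes "mm_space Y" "isometric_embedding (mms_metric Y) m \<psi>"
    and "mm_space W" "isometric_embedding (mms_metric W) m \<xi>"
    and "prohorov_within m \<mu> (law Y m \<psi>) \<epsilon>" "prohorov_within m (law Y m \<psi>) (law W m \<xi>) \<epsilon>'"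
  shows "prohorov_within m \<mu> (law W m \<xi>) (\<epsilon> + \<epsilon>')"
  by (rule prohorov_within_trans[OF _ _ _ _ assms(5,6)])
     (simp_all add: prob_space_law assms(1-4) prob_space.finite_measure)

text \<open>
  Passing to a larger ambient space keeps the Prohorov condition: a closed set \<open>F\<close> of the larger
  space meets the smaller one in a closed set, whose enlargement is contained in that of \<open>F\<close>.
\<close>

lemma prohorov_within_law_isometric:
  assumes X: "mm_space X" and Y: "mm_space Y"
    and \<phi>: "isometric_embedding (mms_metric X) m \<phi>" and \<psi>: "isometric_embedding (mms_metric Y) m \<psi>"
    and h: "isometric_embedding m m' h"
    and within: "prohorov_within m (law X m \<phi>) (law Y m \<psi>) \<epsilon>"
  shows "prohorov_within m' (law X m' (h \<circ> \<phi>)) (law Y m' (h \<circ> \<psi>)) \<epsilon>"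
  unfolding prohorov_within_def
proof (intro conjI allI impI)
  show "0 < \<epsilon>" using within unfolding prohorov_within_def by simp
  interpret PY: prob_space "mms_measure Y" by (rule mm_spaceD(1)[OF Y])
  fix F assume F: "closedin (mtopology_of m') F"
  let ?G = "{z \<in> mspace m. h z \<in> F}"
  have G: "closedin (mtopology_of m) ?G"
    using closedin_continuous_map_preimage[OF isometric_embedding_continuous[OF h] F] by simp
  note \<phi>h = isometric_embedding_comp[OF \<phi> h] and \<psi>h = isometric_embedding_comp[OF \<psi> h]
  note E = enlargement_sets[OF closedin_subset_mspace[OF F]]
    enlargement_sets[OF closedin_subset_mspace[OF G]]
  have "measure (law X m' (h \<circ> \<phi>)) F = measure (law X m \<phi>) ?G"
    unfolding measure_law[OF X \<phi>h closedin_imp_sets_borel_of[OF F]]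
      measure_law[OF X \<phi> closedin_imp_sets_borel_of[OF G]]
    using \<phi> by (intro arg_cong[where f = "measure _"]) (auto simp: isometric_embedding_def)
  also have "\<dots> \<le> measure (law Y m \<psi>) (enlargement m ?G \<epsilon>) + \<epsilon>"
    using within G unfolding prohorov_within_def by blast
  also have "measure (law Y m \<psi>) (enlargement m ?G \<epsilon>)
      \<le> measure (law Y m' (h \<circ> \<psi>)) (enlargement m' F \<epsilon>)"
    unfolding measure_law[OF Y \<psi> E(2)] measure_law[OF Y \<psi>h E(1)]
  proof (rule PY.finite_measure_mono[OF _ embedding_preimage_sets[OF Y \<psi>h E(1)]], intro subsetI)
    fix y assume "y \<in> {y \<in> pts Y. \<psi> y \<in> enlargement m ?G \<epsilon>}"
    then obtain z where z: "y \<in> pts Y" "\<psi> y \<in> mspace m" "z \<in> mspace m" "h z \<in> F"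
      "mdist m (\<psi> y) z < \<epsilon>"
      unfolding enlargement_def by blast
    moreover have "mdist m' (h (\<psi> y)) (h z) = mdist m (\<psi> y) z" "h (\<psi> y) \<in> mspace m'"
      using h z unfolding isometric_embedding_def by auto
    ultimately show "y \<in> {y \<in> pts Y. (h \<circ> \<psi>) y \<in> enlargement m' F \<epsilon>}"
      unfolding enlargement_def by force
  qed
  finally show "measure (law X m' (h \<circ> \<phi>)) F
      \<le> measure (law Y m' (h \<circ> \<psi>)) (enlargement m' F \<epsilon>) + \<epsilon>" by simp
qed

text \<open>
  If two embeddings of the same space are uniformly \<open>\<epsilon>\<close>-close, a point that the first one sends to \<open>F\<close>
  is sent to \<open>F\<^sup>\<epsilon>\<close> by the second. With equal embeddings this gives \<open>gpr A A \<le> 0\<close>; with the two copies of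
  the middle space in a glued space it is the link in the triangle inequality.
\<close>

lemma prohorov_within_law_close:
  assumes X: "mm_space X"
    and \<phi>: "isometric_embedding (mms_metric X) m \<phi>" and \<psi>: "isometric_embedding (mms_metric X) m \<psi>"
    and "0 < \<epsilon>" and close: "\<And>x. x \<in> pts X \<Longrightarrow> mdist m (\<psi> x) (\<phi> x) < \<epsilon>"
  shows "prohorov_within m (law X m \<phi>) (law X m \<psi>) \<epsilon>"
  unfolding prohorov_within_def
proof (intro conjI allI impI)
  interpret P: prob_space "mms_measure X" by (rule mm_spaceD(1)[OF X])
  fix F assume F: "closedin (mtopology_of m) F"
  note E = enlargement_sets[OF closedin_subset_mspace[OF F]]
  have "{x \<in> pts X. \<phi> x \<in> F} \<subseteq> {x \<in> pts X. \<psi> x \<in> enlargement m F \<epsilon>}"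
    using close \<psi> unfolding enlargement_def isometric_embedding_def by auto
  from P.finite_measure_mono[OF this embedding_preimage_sets[OF X \<psi> E]]
  show "measure (law X m \<phi>) F \<le> measure (law X m \<psi>) (enlargement m F \<epsilon>) + \<epsilon>"
    unfolding measure_law[OF X \<phi> closedin_imp_sets_borel_of[OF F]] measure_law[OF X \<psi> E]
    using \<open>0 < \<epsilon>\<close> by simp
qed fact


section \<open>Common ambient spaces\<close>

lemma mm_space_nonempty: "mm_space X \<Longrightarrow> pts X \<noteq> {}"
  using prob_space.not_empty[of "mms_measure X"] mm_spaceD(1,3)[of X] by simp

text \<open>
  The infimum defining \<open>gpr_dist\<close> says nothing unless it is over a nonempty set. Two spaces always
  share an ambient space: both embed in their \<open>\<ell>\<^sup>1\<close>-product, as the slices through a chosen point. This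
  product is separable, so it has a copy with points in \<^typ>\<open>point\<close>.
\<close>

lemma common_ambient_space:
  assumes X: "mm_space X" and Y: "mm_space Y"
  obtains Z :: "point metric" and \<phi> \<psi> where
    "isometric_embedding (mms_metric X) Z \<phi>" "isometric_embedding (mms_metric Y) Z \<psi>"
proof -
  obtain x y where x: "x \<in> pts X" and y: "y \<in> pts Y"
    using mm_space_nonempty[OF X] mm_space_nonempty[OF Y] by blast
  let ?S = "sum_metric (mms_metric X) (mms_metric Y)"
  have 1: "isometric_embedding (mms_metric X) ?S (\<lambda>a. (a, y))"
    and 2: "isometric_embedding (mms_metric Y) ?S (\<lambda>b. (x, b))"
    using x y unfolding isometric_embedding_def by auto
  obtain h :: "_ \<Rightarrow> point" where h: "inj_on h (mspace ?S)"
    by (rule separable_imp_inj_point[OF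
          separable_space_sum_metric[OF mm_spaceD(4)[OF X] mm_spaceD(4)[OF Y]]])
  show ?thesis
    by (rule that[OF isometric_embedding_comp[OF 1 image_metric(2)[OF h]]
          isometric_embedding_comp[OF 2 image_metric(2)[OF h]]])
qed

lemma gpr_dist_lessE:
  assumes X: "mm_space X" and Y: "mm_space Y" and "gpr_dist X Y < \<epsilon>"
  obtains Z :: "point metric" and \<phi> \<psi> where
    "isometric_embedding (mms_metric X) Z \<phi>" "isometric_embedding (mms_metric Y) Z \<psi>"
    "prohorov_within Z (law X Z \<phi>) (law Y Z \<psi>) \<epsilon>"
proof -
  let ?P = "{prohorov Z (law X Z \<phi>) (law Y Z \<psi>) | (Z :: point metric) \<phi> \<psi>.
    isometric_embedding (mms_metric X) Z \<phi> \<and> isometric_embedding (mms_metric Y) Z \<psi>}"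
  have "?P \<noteq> {}"
    by (rule common_ambient_space[OF X Y]) blast
  from cInf_lessD[OF this assms(3)[unfolded gpr_dist_def]]
  obtain Z :: "point metric" and \<phi> \<psi> where
    emb: "isometric_embedding (mms_metric X) Z \<phi>" "isometric_embedding (mms_metric Y) Z \<psi>"
    and less: "prohorov Z (law X Z \<phi>) (law Y Z \<psi>) < \<epsilon>"
    by blast
  show ?thesis
    by (rule that[OF emb prohorov_less_imp_within[OF prob_space_law[OF X emb(1)]
            prob_space.finite_measure[OF prob_space_law[OF Y emb(2)]] sets_distr less]])
qed

lemma gpr_dist_le_if_within:
  assumes "mm_space X" "mm_space Y"
    and "isometric_embedding (mms_metric X) Z \<phi>" "isometric_embedding (mms_metric Y) Z \<psi>"
    and "prohorov_within Z (law X Z \<phi>) (law Y Z \<psi>) \<epsilon>"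
  shows "gpr_dist X Y \<le> \<epsilon>"
  using gpr_dist_le[OF assms(1-4)] prohorov_le_if_within[OF assms(5)] by linarith


section \<open>The product inequality\<close>

text \<open>
  Fubini: integrating the inequality between the sections against the probability measure \<open>B\<close>
  leaves the constant \<open>\<epsilon>\<close> as it is.
\<close>

lemma measure_pair_le_if_sections:
  assumes "prob_space A" "prob_space B" "prob_space C"
    and S: "S \<in> sets (A \<Otimes>\<^sub>M B)" and T: "T \<in> sets (C \<Otimes>\<^sub>M B)" and \<epsilon>: "0 \<le> \<epsilon>"
    and le: "\<And>y. y \<in> space B \<Longrightarrow>
      measure A ((\<lambda>x. (x, y)) -` S) \<le> measure C ((\<lambda>x. (x, y)) -` T) + \<epsilon>"
  shows "measure (A \<Otimes>\<^sub>M B) S \<le> measure (C \<Otimes>\<^sub>M B) T + \<epsilon>"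
proof -
  interpret A: prob_space A by fact
  interpret B: prob_space B by fact
  interpret C: prob_space C by fact
  interpret AB: pair_prob_space A B ..
  interpret CB: pair_prob_space C B ..
  have "ennreal (measure (A \<Otimes>\<^sub>M B) S) = (\<integral>\<^sup>+y. emeasure A ((\<lambda>x. (x, y)) -` S) \<partial>B)"
    unfolding AB.emeasure_eq_measure[symmetric] by (rule AB.emeasure_pair_measure_alt2[OF S])
  also have "\<dots> \<le> (\<integral>\<^sup>+y. emeasure C ((\<lambda>x. (x, y)) -` T) + ennreal \<epsilon> \<partial>B)"
    using le \<epsilon> by (intro nn_integral_mono)
      (simp add: A.emeasure_eq_measure C.emeasure_eq_measure flip: ennreal_plus)
  also have "\<dots> = (\<integral>\<^sup>+y. emeasure C ((\<lambda>x. (x, y)) -` T) \<partial>B) + (\<integral>\<^sup>+y. ennreal \<epsilon> \<partial>B)"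
    by (rule nn_integral_add[OF CB.measurable_emeasure_Pair2[OF T]]) simp
  also have "\<dots> = ennreal (measure (C \<Otimes>\<^sub>M B) T + \<epsilon>)"
    using \<epsilon> by (simp add: CB.emeasure_pair_measure_alt2[OF T, symmetric]
        CB.emeasure_eq_measure B.emeasure_space_1)
  finally show ?thesis
    by (rule ennreal_le_iff[THEN iffD1, rotated]) (use \<epsilon> in simp)
qed

lemma isometric_embedding_map_prod:
  assumes "isometric_embedding (mms_metric X) m \<phi>" "isometric_embedding (mms_metric Y) m' \<psi>"
  shows "isometric_embedding (mms_metric (mm_sum X Y)) (sum_metric m m') (map_prod \<phi> \<psi>)"
proof -
  have \<phi>: "\<phi> a \<in> mspace m" "mdist m (\<phi> a) (\<phi> b) = mdst X a b"
    if "a \<in> pts X" "b \<in> pts X" for a b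
    using assms(1) that unfolding isometric_embedding_def by blast+
  have \<psi>: "\<psi> a \<in> mspace m'" "mdist m' (\<psi> a) (\<psi> b) = mdst Y a b"
    if "a \<in> pts Y" "b \<in> pts Y" for a b
    using assms(2) that unfolding isometric_embedding_def by blast+
  show ?thesis
    unfolding isometric_embedding_def mm_sum_def mms.sel mspace_sum_metric
  proof (intro conjI ballI funcsetI)
    fix p q assume p: "p \<in> pts X \<times> pts Y" and q: "q \<in> pts X \<times> pts Y"
    obtain a b where p': "p = (a, b)" "a \<in> pts X" "b \<in> pts Y" using p by blast
    obtain c d where q': "q = (c, d)" "c \<in> pts X" "d \<in> pts Y" using q by blast
    show "map_prod \<phi> \<psi> p \<in> mspace m \<times> mspace m'"
      unfolding p'(1) using \<phi>(1)[OF p'(2,2)] \<psi>(1)[OF p'(3,3)] by simp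
    show "mdist (sum_metric m m') (map_prod \<phi> \<psi> p) (map_prod \<phi> \<psi> q) =
        mdist (sum_metric (mms_metric X) (mms_metric Y)) p q"
      unfolding p'(1) q'(1) using \<phi>(2)[OF p'(2) q'(2)] \<psi>(2)[OF p'(3) q'(3)] by simp
  qed
qed

text \<open>
  Fix \<open>w\<close>. The section of a closed set \<open>F\<close> at \<open>\<xi> w\<close> is closed in \<open>m\<close>, and moving only the first
  coordinate by less than \<open>\<epsilon>\<close> changes the sum of the distances by less than \<open>\<epsilon>\<close>; hence the enlargement of
  the section lies in the section of the enlargement. All sets are pulled back to the separable
  spaces \<open>X \<times> W\<close> and \<open>Y \<times> W\<close>, where open sets are measurable for the product \<open>\<sigma>\<close>-algebra; in the
  ambient product, whose factors may be nonseparable, this can fail.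
\<close>

lemma prohorov_within_law_sum_fst:
  assumes X: "mm_space X" and Y: "mm_space Y" and W: "mm_space W"
    and \<phi>: "isometric_embedding (mms_metric X) m \<phi>" and \<psi>: "isometric_embedding (mms_metric Y) m \<psi>"
    and \<xi>: "isometric_embedding (mms_metric W) m' \<xi>"
    and within: "prohorov_within m (law X m \<phi>) (law Y m \<psi>) \<epsilon>"
  shows "prohorov_within (sum_metric m m')
    (law (mm_sum X W) (sum_metric m m') (map_prod \<phi> \<xi>))
    (law (mm_sum Y W) (sum_metric m m') (map_prod \<psi> \<xi>)) \<epsilon>"
  unfolding prohorov_within_def
proof (intro conjI allI impI)
  show pos: "0 < \<epsilon>" using within unfolding prohorov_within_def by simp
  let ?M = "sum_metric m m'"
  interpret PY: prob_space "mms_measure Y" by (rule mm_spaceD(1)[OF Y])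
  fix F assume F: "closedin (mtopology_of ?M) F"
  note E = enlargement_sets[OF closedin_subset_mspace[OF F]]
  note XW = mm_space_mm_sum[OF X W] isometric_embedding_map_prod[OF \<phi> \<xi>]
  note YW = mm_space_mm_sum[OF Y W] isometric_embedding_map_prod[OF \<psi> \<xi>]
  show "measure (law (mm_sum X W) ?M (map_prod \<phi> \<xi>)) F
      \<le> measure (law (mm_sum Y W) ?M (map_prod \<psi> \<xi>)) (enlargement ?M F \<epsilon>) + \<epsilon>"
    unfolding measure_law[OF XW closedin_imp_sets_borel_of[OF F]] measure_law[OF YW E]
    unfolding mm_sum_def mms.sel
  proof (rule measure_pair_le_if_sections)
    fix w assume "w \<in> space (mms_measure W)"
    then have w: "w \<in> pts W" by (simp add: mm_spaceD(3)[OF W])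
    then have \<xi>w: "\<xi> w \<in> mspace m'" using \<xi> unfolding isometric_embedding_def by auto
    let ?G = "{a \<in> mspace m. (a, \<xi> w) \<in> F}"
    have "isometric_embedding m ?M (\<lambda>a. (a, \<xi> w))"
      using \<xi>w unfolding isometric_embedding_def by auto
    from closedin_continuous_map_preimage[OF isometric_embedding_continuous[OF this] F]
    have G: "closedin (mtopology_of m) ?G" by simp
    note EG = enlargement_sets[OF closedin_subset_mspace[OF G]]
    have "(\<lambda>x. (x, w)) -` {p \<in> mspace (sum_metric (mms_metric X) (mms_metric W)). map_prod \<phi> \<xi> p \<in> F}
        = {x \<in> pts X. \<phi> x \<in> ?G}"
      using w \<phi> unfolding isometric_embedding_def by auto
    then have "measure (mms_measure X) ((\<lambda>x. (x, w)) -`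
        {p \<in> mspace (sum_metric (mms_metric X) (mms_metric W)). map_prod \<phi> \<xi> p \<in> F})
        = measure (law X m \<phi>) ?G"
      by (simp only: measure_law[OF X \<phi> closedin_imp_sets_borel_of[OF G]])
    also have "\<dots> \<le> measure (law Y m \<psi>) (enlargement m ?G \<epsilon>) + \<epsilon>"
      using within G unfolding prohorov_within_def by blast
    also have "measure (law Y m \<psi>) (enlargement m ?G \<epsilon>) \<le> measure (mms_measure Y) ((\<lambda>y. (y, w)) -`
        {p \<in> mspace (sum_metric (mms_metric Y) (mms_metric W)). map_prod \<psi> \<xi> p \<in> enlargement ?M F \<epsilon>})"
      unfolding measure_law[OF Y \<psi> EG]
    proof (rule PY.finite_measure_mono)
      show "{y \<in> pts Y. \<psi> y \<in> enlargement m ?G \<epsilon>} \<subseteq> (\<lambda>y. (y, w)) -`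
        {p \<in> mspace (sum_metric (mms_metric Y) (mms_metric W)). map_prod \<psi> \<xi> p \<in> enlargement ?M F \<epsilon>}"
        using w \<xi>w unfolding enlargement_def by (force simp: mdist_self)
      show "(\<lambda>y. (y, w)) -` {p \<in> mspace (sum_metric (mms_metric Y) (mms_metric W)).
          map_prod \<psi> \<xi> p \<in> enlargement ?M F \<epsilon>} \<in> sets (mms_measure Y)"
        using sets_Pair2[OF embedding_preimage_sets[OF YW E, unfolded mm_sum_def mms.sel]] .
    qed
    finally show "measure (mms_measure X) ((\<lambda>x. (x, w)) -`
        {p \<in> mspace (sum_metric (mms_metric X) (mms_metric W)). map_prod \<phi> \<xi> p \<in> F})
      \<le> measure (mms_measure Y) ((\<lambda>y. (y, w)) -`
        {p \<in> mspace (sum_metric (mms_metric Y) (mms_metric W)). map_prod \<psi> \<xi> p \<in> enlargement ?M F \<epsilon>}) + \<epsilon>"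
      by simp
  qed (use pos mm_spaceD(1)[OF X] mm_spaceD(1)[OF Y] mm_spaceD(1)[OF W]
      embedding_preimage_sets[OF XW closedin_imp_sets_borel_of[OF F], unfolded mm_sum_def mms.sel]
      embedding_preimage_sets[OF YW E, unfolded mm_sum_def mms.sel] in simp_all)
qed

lemma isometric_embedding_swap:
  "isometric_embedding (sum_metric m m') (sum_metric m' m) prod.swap"
  unfolding isometric_embedding_def by auto

lemma law_sum_swap:
  assumes X: "mm_space X" and Y: "mm_space Y"
    and \<phi>: "isometric_embedding (mms_metric X) m \<phi>" and \<psi>: "isometric_embedding (mms_metric Y) m' \<psi>"
  shows "law (mm_sum X Y) (sum_metric m m') (prod.swap \<circ> map_prod \<psi> \<phi> \<circ> prod.swap) =
    law (mm_sum Y X) (sum_metric m m') (prod.swap \<circ> map_prod \<psi> \<phi>)"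
proof -
  interpret PX: prob_space "mms_measure X" by (rule mm_spaceD(1)[OF X])
  interpret PY: prob_space "mms_measure Y" by (rule mm_spaceD(1)[OF Y])
  interpret YX: pair_sigma_finite "mms_measure Y" "mms_measure X" ..
  have "prod.swap \<circ> map_prod \<psi> \<phi> \<in> mms_measure (mm_sum Y X) \<rightarrow>\<^sub>M borel_of (mtopology_of (sum_metric m m'))"
    by (rule isometric_embedding_mm_measurable[OF mm_space_mm_sum[OF Y X]
          isometric_embedding_comp[OF isometric_embedding_map_prod[OF \<psi> \<phi>] isometric_embedding_swap]])
  then have meas: "prod.swap \<circ> map_prod \<psi> \<phi> \<in>
      mms_measure Y \<Otimes>\<^sub>M mms_measure X \<rightarrow>\<^sub>M borel_of (mtopology_of (sum_metric m m'))"
    by (simp add: mm_sum_def)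
  have swap: "(\<lambda>(x, y). (y, x)) = (prod.swap :: 'b \<times> 'a \<Rightarrow> _)"
    "(\<lambda>(x, y). (y, x)) = (prod.swap :: 'a \<times> 'b \<Rightarrow> _)" by auto
  have "law (mm_sum Y X) (sum_metric m m') (prod.swap \<circ> map_prod \<psi> \<phi>) =
    distr (distr (mms_measure X \<Otimes>\<^sub>M mms_measure Y) (mms_measure Y \<Otimes>\<^sub>M mms_measure X) prod.swap)
      (borel_of (mtopology_of (sum_metric m m'))) (prod.swap \<circ> map_prod \<psi> \<phi>)"
    using YX.distr_pair_swap unfolding mm_sum_def mms.sel swap by simp
  also have "\<dots> = distr (mms_measure X \<Otimes>\<^sub>M mms_measure Y)
      (borel_of (mtopology_of (sum_metric m m'))) (prod.swap \<circ> map_prod \<psi> \<phi> \<circ> prod.swap)"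
    using measurable_pair_swap'[of "mms_measure X" "mms_measure Y"] unfolding swap
    by (intro distr_distr[OF meas])
  finally show ?thesis by (simp add: mm_sum_def)
qed

lemma prohorov_within_law_sum_snd:
  assumes X: "mm_space X" and Y: "mm_space Y" and W: "mm_space W"
    and \<phi>: "isometric_embedding (mms_metric X) m' \<phi>" and \<psi>: "isometric_embedding (mms_metric Y) m' \<psi>"
    and \<xi>: "isometric_embedding (mms_metric W) m \<xi>"
    and within: "prohorov_within m' (law X m' \<phi>) (law Y m' \<psi>) \<epsilon>"
  shows "prohorov_within (sum_metric m m')
    (law (mm_sum W X) (sum_metric m m') (map_prod \<xi> \<phi>))
    (law (mm_sum W Y) (sum_metric m m') (map_prod \<xi> \<psi>)) \<epsilon>"
proof -
  have swap: "prod.swap \<circ> map_prod f g \<circ> prod.swap = map_prod g f"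
    for f :: "'x \<Rightarrow> 'y" and g :: "'z \<Rightarrow> 'w" by auto
  show ?thesis
    using prohorov_within_law_isometric[OF mm_space_mm_sum[OF X W] mm_space_mm_sum[OF Y W]
        isometric_embedding_map_prod[OF \<phi> \<xi>] isometric_embedding_map_prod[OF \<psi> \<xi>]
        isometric_embedding_swap prohorov_within_law_sum_fst[OF X Y W \<phi> \<psi> \<xi> within]]
    unfolding law_sum_swap[OF W X \<xi> \<phi>, symmetric] law_sum_swap[OF W Y \<xi> \<psi>, symmetric] swap .
qed

lemma gpr_dist_mm_sum_le:
  assumes X1: "mm_space X1" and X2: "mm_space X2" and Y1: "mm_space Y1" and Y2: "mm_space Y2"
  shows "gpr_dist (mm_sum X1 X2) (mm_sum Y1 Y2) \<le> gpr_dist X1 Y1 + gpr_dist X2 Y2"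
proof (rule field_le_epsilon)
  fix e :: real assume "0 < e"
  then have less: "gpr_dist X1 Y1 < gpr_dist X1 Y1 + e / 2" "gpr_dist X2 Y2 < gpr_dist X2 Y2 + e / 2"
    by simp_all
  obtain Z1 :: "point metric" and \<phi>1 \<psi>1 where 1:
    "isometric_embedding (mms_metric X1) Z1 \<phi>1" "isometric_embedding (mms_metric Y1) Z1 \<psi>1"
    "prohorov_within Z1 (law X1 Z1 \<phi>1) (law Y1 Z1 \<psi>1) (gpr_dist X1 Y1 + e / 2)"
    by (rule gpr_dist_lessE[OF X1 Y1 less(1)])
  obtain Z2 :: "point metric" and \<phi>2 \<psi>2 where 2:
    "isometric_embedding (mms_metric X2) Z2 \<phi>2" "isometric_embedding (mms_metric Y2) Z2 \<psi>2"
    "prohorov_within Z2 (law X2 Z2 \<phi>2) (law Y2 Z2 \<psi>2) (gpr_dist X2 Y2 + e / 2)"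
    by (rule gpr_dist_lessE[OF X2 Y2 less(2)])
  have "gpr_dist (mm_sum X1 X2) (mm_sum Y1 Y2) \<le> (gpr_dist X1 Y1 + e / 2) + (gpr_dist X2 Y2 + e / 2)"
    by (rule gpr_dist_le_if_within[OF mm_space_mm_sum[OF X1 X2] mm_space_mm_sum[OF Y1 Y2]
          isometric_embedding_map_prod[OF 1(1) 2(1)] isometric_embedding_map_prod[OF 1(2) 2(2)]
          prohorov_within_law_trans[OF
            mm_space_mm_sum[OF Y1 X2] isometric_embedding_map_prod[OF 1(2) 2(1)]
            mm_space_mm_sum[OF Y1 Y2] isometric_embedding_map_prod[OF 1(2) 2(2)]
            prohorov_within_law_sum_fst[OF X1 Y1 X2 1(1,2) 2(1) 1(3)]
            prohorov_within_law_sum_snd[OF X2 Y2 Y1 2(1,2) 1(2) 2(3)]]])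
  then show "gpr_dist (mm_sum X1 X2) (mm_sum Y1 Y2) \<le> gpr_dist X1 Y1 + gpr_dist X2 Y2 + e" by simp
qed

lemma gpr_rep: "gpr A B = gpr_dist (rep_mm A) (rep_mm B)"
  by (simp add: gpr_def)

lemma gpr_boxplus_le: "gpr (X1 \<boxplus> X2) (Y1 \<boxplus> Y2) \<le> gpr X1 Y1 + gpr X2 Y2"
  unfolding boxplus_def gpr_mm_class[OF mm_space_mm_sum[OF rep_mm rep_mm] mm_space_mm_sum[OF rep_mm rep_mm]]
    gpr_rep[of X1] gpr_rep[of X2]
  by (rule gpr_dist_mm_sum_le[OF rep_mm rep_mm rep_mm rep_mm])


section \<open>Gluing and the triangle inequality\<close>

text \<open>
  Two metric spaces \<open>m\<close> and \<open>m'\<close> contain isometric copies \<open>f\<close> and \<open>g\<close> of the same nonempty family. Identifying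
  \<open>f i\<close> with \<open>g i\<close> would require a quotient of the disjoint union. Instead every \<open>f i\<close> is joined to \<open>g i\<close>
  by a bridge of length \<open>\<delta> > 0\<close>, and the distance of a point of \<open>m\<close> to a point of \<open>m'\<close> is the infimum of
  the lengths of the paths that cross one bridge. Because of \<open>\<delta>\<close> this is a metric on the disjoint union
  itself, and \<open>\<delta>\<close> is arbitrarily small in the application.
\<close>

context
  fixes m :: "'a metric" and m' :: "'b metric" and I :: "'i set" and f g and \<delta> :: real
  assumes I: "I \<noteq> {}" and f: "\<And>i. i \<in> I \<Longrightarrow> f i \<in> mspace m"
    and g: "\<And>i. i \<in> I \<Longrightarrow> g i \<in> mspace m'"
    and fg: "\<And>i j. i \<in> I \<Longrightarrow> j \<in> I \<Longrightarrow> mdist m (f i) (f j) = mdist m' (g i) (g j)"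
    and \<delta>: "0 < \<delta>"
begin

definition bridge_dist :: "'a \<Rightarrow> 'b \<Rightarrow> real"
  where "bridge_dist a b = (INF i\<in>I. mdist m a (f i) + mdist m' (g i) b) + \<delta>"

fun glued_dist :: "'a + 'b \<Rightarrow> 'a + 'b \<Rightarrow> real"
  where "glued_dist (Inl a) (Inl b) = mdist m a b"
  | "glued_dist (Inl a) (Inr b) = bridge_dist a b"
  | "glued_dist (Inr b) (Inl a) = bridge_dist a b"
  | "glued_dist (Inr a) (Inr b) = mdist m' a b"

lemma bridge_dist_le: "i \<in> I \<Longrightarrow> bridge_dist a b \<le> mdist m a (f i) + mdist m' (g i) b + \<delta>"
  unfolding bridge_dist_def
  by (intro add_mono order_refl cINF_lower bdd_belowI2[where m = 0]) (auto intro: add_nonneg_nonneg)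

lemma le_bridge_dist:
  "(\<And>i. i \<in> I \<Longrightarrow> c \<le> mdist m a (f i) + mdist m' (g i) b + \<delta>) \<Longrightarrow> c \<le> bridge_dist a b"
  using cINF_greatest[OF I, of "c - \<delta>" "\<lambda>i. mdist m a (f i) + mdist m' (g i) b"]
  unfolding bridge_dist_def by (simp add: algebra_simps)

lemma bridge_dist_pos: "0 < bridge_dist a b"
  using le_bridge_dist[of \<delta> a b] \<delta> by (simp add: add_nonneg_nonneg)

lemma bridge_dist_triangle_left:
  assumes "a \<in> mspace m" "a' \<in> mspace m"
  shows "bridge_dist a b \<le> mdist m a a' + bridge_dist a' b"
proof -
  have "bridge_dist a b - mdist m a a' \<le> bridge_dist a' b"
  proof (rule le_bridge_dist)
    fix i assume i: "i \<in> I"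
    then show "bridge_dist a b - mdist m a a' \<le> mdist m a' (f i) + mdist m' (g i) b + \<delta>"
      using bridge_dist_le[OF i, of a b] mdist_triangle[OF assms f[OF i]] by simp
  qed
  then show ?thesis by simp
qed

lemma bridge_dist_triangle_right:
  assumes "b \<in> mspace m'" "b' \<in> mspace m'"
  shows "bridge_dist a b \<le> bridge_dist a b' + mdist m' b' b"
proof -
  have "bridge_dist a b - mdist m' b' b \<le> bridge_dist a b'"
  proof (rule le_bridge_dist)
    fix i assume i: "i \<in> I"
    then show "bridge_dist a b - mdist m' b' b \<le> mdist m a (f i) + mdist m' (g i) b' + \<delta>"
      using bridge_dist_le[OF i, of a b] mdist_triangle[OF g[OF i] assms(2,1)] by simp
  qed
  then show ?thesis by simp
qed

text \<open>
  A path that crosses bridge \<open>i\<close> and returns over bridge \<open>j\<close> offers no shortcut, since the distance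
  of \<open>g i\<close> and \<open>g j\<close> equals that of \<open>f i\<close> and \<open>f j\<close>.
\<close>

lemma mdist_left_le_bridge_dist:
  assumes "a \<in> mspace m" "a' \<in> mspace m" "b \<in> mspace m'"
  shows "mdist m a a' \<le> bridge_dist a b + bridge_dist a' b"
proof -
  have "mdist m a a' - bridge_dist a' b \<le> bridge_dist a b"
  proof (rule le_bridge_dist)
    fix i assume i: "i \<in> I"
    have "mdist m a a' - (mdist m a (f i) + mdist m' (g i) b + \<delta>) \<le> bridge_dist a' b"
    proof (rule le_bridge_dist)
      fix j assume j: "j \<in> I"
      have "mdist m a a' \<le> mdist m a (f i) + mdist m (f i) (f j) + mdist m a' (f j)"
        using mdist_triangle[OF assms(1) f[OF i] assms(2)] mdist_triangle[OF f[OF i] f[OF j] assms(2)]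
        by (simp add: mdist_commute)
      moreover have "mdist m (f i) (f j) \<le> mdist m' (g i) b + mdist m' (g j) b"
        using mdist_triangle[OF g[OF i] assms(3) g[OF j]] fg[OF i j] by (simp add: mdist_commute)
      ultimately show "mdist m a a' - (mdist m a (f i) + mdist m' (g i) b + \<delta>)
          \<le> mdist m a' (f j) + mdist m' (g j) b + \<delta>"
        using \<delta> by simp
    qed
    then show "mdist m a a' - bridge_dist a' b \<le> mdist m a (f i) + mdist m' (g i) b + \<delta>" by simp
  qed
  then show ?thesis by simp
qed

lemma mdist_right_le_bridge_dist:
  assumes "b \<in> mspace m'" "b' \<in> mspace m'" "a \<in> mspace m"
  shows "mdist m' b b' \<le> bridge_dist a b + bridge_dist a b'"
proof -
  have "mdist m' b b' - bridge_dist a b' \<le> bridge_dist a b"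
  proof (rule le_bridge_dist)
    fix i assume i: "i \<in> I"
    have "mdist m' b b' - (mdist m a (f i) + mdist m' (g i) b + \<delta>) \<le> bridge_dist a b'"
    proof (rule le_bridge_dist)
      fix j assume j: "j \<in> I"
      have "mdist m' b b' \<le> mdist m' (g i) b + mdist m' (g i) (g j) + mdist m' (g j) b'"
        using mdist_triangle[OF assms(1) g[OF i] assms(2)] mdist_triangle[OF g[OF i] g[OF j] assms(2)]
        by (simp add: mdist_commute)
      moreover have "mdist m' (g i) (g j) \<le> mdist m a (f i) + mdist m a (f j)"
        using mdist_triangle[OF f[OF i] assms(3) f[OF j]] fg[OF i j] by (simp add: mdist_commute)
      ultimately show "mdist m' b b' - (mdist m a (f i) + mdist m' (g i) b + \<delta>)
          \<le> mdist m a (f j) + mdist m' (g j) b' + \<delta>"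
        using \<delta> by simp
    qed
    then show "mdist m' b b' - bridge_dist a b' \<le> mdist m a (f i) + mdist m' (g i) b + \<delta>" by simp
  qed
  then show ?thesis by simp
qed

lemma Metric_space_glued: "Metric_space (mspace m <+> mspace m') glued_dist"
proof
  fix x y z :: "'a + 'b"
  show "0 \<le> glued_dist x y"
    using bridge_dist_pos by (cases x; cases y) (auto intro: less_imp_le)
  show "glued_dist x y = glued_dist y x"
    by (cases x; cases y) (simp_all add: mdist_commute)
  assume x: "x \<in> mspace m <+> mspace m'" and y: "y \<in> mspace m <+> mspace m'"
  show "(glued_dist x y = 0) \<longleftrightarrow> (x = y)"
    using x y bridge_dist_pos by (cases x; cases y) (auto simp: less_imp_neq[symmetric])
  assume z: "z \<in> mspace m <+> mspace m'"
  show "glued_dist x z \<le> glued_dist x y + glued_dist y z"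
    using x y z
    by (cases x; cases y; cases z)
       (auto intro: mdist_triangle bridge_dist_triangle_left bridge_dist_triangle_right
          mdist_left_le_bridge_dist mdist_right_le_bridge_dist
          order_trans[OF bridge_dist_triangle_left] order_trans[OF bridge_dist_triangle_right]
          simp: mdist_commute)
qed

lemma glued_metric:
  obtains Z where "isometric_embedding m Z Inl" "isometric_embedding m' Z Inr"
    and "\<And>i. i \<in> I \<Longrightarrow> mdist Z (Inr (g i)) (Inl (f i)) \<le> \<delta>"
proof
  let ?Z = "metric (mspace m <+> mspace m', glued_dist)"
  note sel = Metric_space.mspace_metric[OF Metric_space_glued]
    Metric_space.mdist_metric[OF Metric_space_glued]
  show "isometric_embedding m ?Z Inl" "isometric_embedding m' ?Z Inr"
    unfolding isometric_embedding_def sel by auto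
  fix i assume i: "i \<in> I"
  show "mdist ?Z (Inr (g i)) (Inl (f i)) \<le> \<delta>"
    unfolding sel using bridge_dist_le[OF i, of "f i" "g i"] f[OF i] g[OF i] by (simp add: mdist_self)
qed

end

text \<open>
  The slack \<open>e\<close> is spent in three equal parts: one for each of the two nearly optimal embeddings,
  one for crossing from the first copy of \<open>Y\<close> to the second in the glued space. The bridge length
  \<open>e / 6\<close> makes the two copies strictly closer than \<open>e / 3\<close>.
\<close>

lemma gpr_dist_triangle:
  assumes X: "mm_space X" and Y: "mm_space Y" and W: "mm_space W"
  shows "gpr_dist X W \<le> gpr_dist X Y + gpr_dist Y W"
proof (rule field_le_epsilon)
  fix e :: real assume e: "0 < e"
  then have less: "gpr_dist X Y < gpr_dist X Y + e / 3" "gpr_dist Y W < gpr_dist Y W + e / 3"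
    by simp_all
  obtain Z1 :: "point metric" and \<phi> \<psi> where 1:
    "isometric_embedding (mms_metric X) Z1 \<phi>" "isometric_embedding (mms_metric Y) Z1 \<psi>"
    "prohorov_within Z1 (law X Z1 \<phi>) (law Y Z1 \<psi>) (gpr_dist X Y + e / 3)"
    by (rule gpr_dist_lessE[OF X Y less(1)])
  obtain Z2 :: "point metric" and \<psi>' \<xi> where 2:
    "isometric_embedding (mms_metric Y) Z2 \<psi>'" "isometric_embedding (mms_metric W) Z2 \<xi>"
    "prohorov_within Z2 (law Y Z2 \<psi>') (law W Z2 \<xi>) (gpr_dist Y W + e / 3)"
    by (rule gpr_dist_lessE[OF Y W less(2)])
  obtain Z where L: "isometric_embedding Z1 Z Inl" and R: "isometric_embedding Z2 Z Inr"
    and close: "\<And>y. y \<in> pts Y \<Longrightarrow> mdist Z (Inr (\<psi>' y)) (Inl (\<psi> y)) \<le> e / 6"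
    by (rule glued_metric[of "pts Y" \<psi> Z1 \<psi>' Z2 "e / 6"])
       (use mm_space_nonempty[OF Y] 1(2) 2(1) e in \<open>auto simp: isometric_embedding_def\<close>)
  note LX = isometric_embedding_comp[OF 1(1) L] and LY = isometric_embedding_comp[OF 1(2) L]
    and RY = isometric_embedding_comp[OF 2(1) R] and RW = isometric_embedding_comp[OF 2(2) R]
  have "prohorov_within Z (law Y Z (Inl \<circ> \<psi>)) (law Y Z (Inr \<circ> \<psi>')) (e / 3)"
    by (rule prohorov_within_law_close[OF Y LY RY]) (use e close in force)+
  from prohorov_within_law_trans[OF Y RY W RW
      prohorov_within_law_trans[OF Y LY Y RY prohorov_within_law_isometric[OF X Y 1(1,2) L 1(3)] this]
      prohorov_within_law_isometric[OF Y W 2(1,2) R 2(3)]]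
  have "gpr_dist X W \<le> (gpr_dist X Y + e / 3 + e / 3) + (gpr_dist Y W + e / 3)"
    by (rule gpr_dist_le_if_within[OF X W LX RW])
  then show "gpr_dist X W \<le> gpr_dist X Y + gpr_dist Y W + e" by simp
qed

lemma gpr_triangle: "gpr A C \<le> gpr A B + gpr B C"
  unfolding gpr_rep by (rule gpr_dist_triangle[OF rep_mm rep_mm rep_mm])

lemma gpr_self_le: "gpr A A \<le> 0"
  unfolding gpr_rep
proof (rule field_le_epsilon)
  fix e :: real assume e: "0 < e"
  let ?X = "rep_mm A"
  have id: "isometric_embedding (mms_metric ?X) (mms_metric ?X) (\<lambda>x. x)"
    unfolding isometric_embedding_def by simp
  have "gpr_dist ?X ?X \<le> e"
    by (rule gpr_dist_le_if_within[OF rep_mm rep_mm id id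
          prohorov_within_law_close[OF rep_mm id id e]]) (simp add: e mdist_self)
  then show "gpr_dist ?X ?X \<le> 0 + e" by simp
qed


section \<open>Continuity\<close>

lemma openin_gpr_ball: "openin gpr_topology {B. gpr A B < e}"
  unfolding openin_gpr_topology
proof (intro ballI)
  fix B assume B: "B \<in> {B. gpr A B < e}"
  show "\<exists>d>0. \<forall>C. gpr B C < d \<longrightarrow> C \<in> {B. gpr A B < e}"
  proof (intro exI[of _ "e - gpr A B"] conjI allI impI)
    fix C assume "gpr B C < e - gpr A B"
    then show "C \<in> {B. gpr A B < e}" using gpr_triangle[of A C B] by simp
  qed (use B in simp)
qed

lemma topspace_gpr_topology [simp]: "topspace gpr_topology = UNIV"
proof -
  have "openin gpr_topology UNIV"
    unfolding openin_gpr_topology using zero_less_one by blast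
  then show ?thesis using openin_subset by blast
qed

theorem lemma2p1:
  shows "continuous_map (prod_topology gpr_topology gpr_topology) gpr_topology (\<lambda>(A, B). A \<boxplus> B) \<and>
    (\<forall>X\<^sub>1 X\<^sub>2 Y\<^sub>1 Y\<^sub>2. gpr (X\<^sub>1 \<boxplus> X\<^sub>2) (Y\<^sub>1 \<boxplus> Y\<^sub>2) \<le> gpr X\<^sub>1 Y\<^sub>1 + gpr X\<^sub>2 Y\<^sub>2)"
proof (intro conjI allI)
  show "gpr (X\<^sub>1 \<boxplus> X\<^sub>2) (Y\<^sub>1 \<boxplus> Y\<^sub>2) \<le> gpr X\<^sub>1 Y\<^sub>1 + gpr X\<^sub>2 Y\<^sub>2" for X\<^sub>1 X\<^sub>2 Y\<^sub>1 Y\<^sub>2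
    by (rule gpr_boxplus_le)
  show "continuous_map (prod_topology gpr_topology gpr_topology) gpr_topology (\<lambda>(A, B). A \<boxplus> B)"
    unfolding continuous_map_def
  proof (intro conjI allI impI)
    fix U assume U: "openin gpr_topology U"
    show "openin (prod_topology gpr_topology gpr_topology)
        {p \<in> topspace (prod_topology gpr_topology gpr_topology). (case p of (A, B) \<Rightarrow> A \<boxplus> B) \<in> U}"
      unfolding openin_prod_topology_alt
    proof (intro allI impI)
      fix A B
      assume "(A, B) \<in> {p \<in> topspace (prod_topology gpr_topology gpr_topology).
        (case p of (A, B) \<Rightarrow> A \<boxplus> B) \<in> U}"
      then have "A \<boxplus> B \<in> U" by simp
      then obtain e where e: "0 < e" "\<And>C. gpr (A \<boxplus> B) C < e \<Longrightarrow> C \<in> U"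
        using U unfolding openin_gpr_topology by blast
      have "A' \<boxplus> B' \<in> U" if "gpr A A' < e / 2" "gpr B B' < e / 2" for A' B'
        using gpr_boxplus_le[of A B A' B'] that by (intro e(2)) simp
      then show "\<exists>V W. openin gpr_topology V \<and> openin gpr_topology W \<and> A \<in> V \<and> B \<in> W \<and>
          V \<times> W \<subseteq> {p \<in> topspace (prod_topology gpr_topology gpr_topology).
            (case p of (A, B) \<Rightarrow> A \<boxplus> B) \<in> U}"
        using gpr_self_le[of A] gpr_self_le[of B] e(1)
        by (intro exI[of _ "{C. gpr A C < e / 2}"] exI[of _ "{C. gpr B C < e / 2}"]
            conjI openin_gpr_ball) auto
    qed
  qed simp
qed

end
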